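(* Let $N\ge1$, $L\ge2$ be integers, $\nu,\lambda\in\{1,-1\}$, and let $k$ be an algebraically closed field whose characteristic does not divide $2NL$. Let $A_{NL}^{\nu\lambda}$ be Suzuki's Hopf algebra over $k$ and $C\subset A_{NL}^{\nu\lambda}$ the span of $x_{11},x_{12},x_{21},x_{22}$. For $\omega\in k$ let $\theta_\omega:C\to k$ be the linear functional with $\theta_\omega(x_{ij})=\delta_{ij}\omega$ $(i,j=1,2)$; a coribbon element extending $\theta_\omega$ is also denoted $\theta_\omega$. (1) Let $\alpha,\beta\in k^\times$ satisfy $(\alpha\beta)^N=\nu$, $(\alpha\beta^{-1})^L=\lambda$. Then $\theta_\omega$ extends to a coribbon element of the braided bialgebra $(A_{NL}^{\nu\lambda},\sigma_{\alpha\beta})$ if and only if $\omega^{2N}=\alpha^{2N}$, and any coribbon element of the braided bialgebra $(A_{NL}^{\nu\lambda},\sigma_{\alpha\beta})$ is of the form $\theta_\omega$. In addition, $\theta_\omega$ is a coribbon element of the braided Hopf algebra $(A_{NL}^{\nu\lambda},\sigma_{\alpha\beta})$ if and only if $\omega=\pm\beta^{-1}$. Therefore there are exactly two coribbon elements of the braided Hopf algebra $(A_{NL}^{\nu\lambda},\sigma_{\alpha\beta})$. (2) Let $L=2$ and let $\gamma,\delta\in k^\times$ satisfy $\gamma^2=\delta^2$, $\gamma^{2N}=1$. Then $\theta_\omega$ extends to a coribbon element of the braided bialgebra $(A_{N2}^{\nu\lambda},\tau^\lambda_{\gamma\delta})$ if and only if $\omega^{2N}=1$, and any coribbon element of the braided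 bialgebra $(A_{N2}^{\nu\lambda},\tau^\lambda_{\gamma\delta})$ is of the form $\theta_\omega$. In addition, $\theta_\omega$ is a coribbon element of the braided Hopf algebra $(A_{N2}^{\nu\lambda},\tau^\lambda_{\gamma\delta})$ if and only if $\omega=\pm\gamma^{-1}$. Therefore there are exactly two coribbon elements of the braided Hopf algebra $(A_{N2}^{\nu\lambda},\tau^\lambda_{\gamma\delta})$.
   Context: Suzuki's Hopf algebra. $A_{NL}^{\nu\lambda}$ is the $k$-algebra generated by $x_{11},x_{12},x_{21},x_{22}$ with relations $x_{11}^2=x_{22}^2$, $x_{12}^2=x_{21}^2$, $x_{ij}x_{lm}=0$ whenever $i-j\not\equiv l-m\pmod 2$, $x_{11}^{2N}+\nu x_{12}^{2N}=1$, $\chi_{11}^L=\chi_{22}^L$, $\chi_{21}^L=\lambda\chi_{12}^L$. Here, for $m\ge1$, $\chi_{11}^m=x_{11}x_{22}x_{11}\cdots$, $\chi_{22}^m=x_{22}x_{11}x_{22}\cdots$, $\chi_{12}^m=x_{12}x_{21}x_{12}\cdots$, $\chi_{21}^m=x_{21}x_{12}x_{21}\cdots$ are alternating products of $m$ factors. It is a Hopf algebra of dimension $4NL$ with $\Delta(x_{ij})=x_{i1}\otimes x_{1j}+x_{i2}\otimes x_{2j}$, $\varepsilon(x_{ij})=\delta_{ij}$, $S(x_{ij})=x_{ji}^{4N-1}$; the elements $x_{11},x_{12},x_{21},x_{22}$ are linearly independent. Braidings. A braiding of a bialgebra $A$ is a convolution-invertible $\sigma:A\otimes A\to k$ with $\sum\sigma(x_{(1)},y_{(1)})x_{(2)}y_{(2)}=\sum\sigma(x_{(2)},y_{(2)})y_{(1)}x_{(1)}$,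 $\sigma(xy,z)=\sum\sigma(x,z_{(1)})\sigma(y,z_{(2)})$, $\sigma(x,yz)=\sum\sigma(x_{(1)},z)\sigma(x_{(2)},y)$ for all $x,y,z$; then $(A,\sigma)$ is a braided bialgebra (braided Hopf algebra if $A$ is a Hopf algebra). $\sigma_{\alpha\beta}$ (for $(\alpha\beta)^N=\nu$, $(\alpha\beta^{-1})^L=\lambda$) is the unique braiding of $A_{NL}^{\nu\lambda}$ with $\sigma_{\alpha\beta}(x_{12},x_{12})=\sigma_{\alpha\beta}(x_{21},x_{21})=\alpha$, $\sigma_{\alpha\beta}(x_{12},x_{21})=\sigma_{\alpha\beta}(x_{21},x_{12})=\beta$ and all other values on pairs of generators $0$. For $L=2$, $\gamma^2=\delta^2$, $\gamma^{2N}=1$, $\tau^\lambda_{\gamma\delta}$ is the unique braiding of $A_{N2}^{\nu\lambda}$ with $\tau^\lambda_{\gamma\delta}(x_{11},x_{11})=\tau^\lambda_{\gamma\delta}(x_{22},x_{22})=\gamma$, $\tau^\lambda_{\gamma\delta}(x_{11},x_{22})=\delta$, $\tau^\lambda_{\gamma\delta}(x_{22},x_{11})=\lambda\delta$ and all other values on pairs of generators $0$ (existence is due to S. Suzuki). Coribbon elements. A coribbon element of a braided bialgebra $(A,\sigma)$ is an invertible $\theta\in A^\ast$ (convolution algebra) with (CR1) $\sum\theta(x_{(1)})x_{(2)}=\sum\theta(x_{(2)})x_{(1)}$; (CR2) $\theta(xy)=\sum\sigma^{-1}(x_{(1)},y_{(1)})\theta(x_{(2)})\theta(y_{(2)})\sigma^{-1}(y_{(3)},x_{(3)})$;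 (CR3) $\theta(1)=1$, for all $x,y\in A$. A coribbon element of a braided Hopf algebra is required in addition to satisfy (CR4) $\theta\circ S=\theta$. *)

theory Defs
  imports
    "HOL-Library.Poly_Mapping"
    "HOL-Library.Numeral_Type"
    "HOL-Computational_Algebra.Polynomial"
begin

section \<open>Algebras and tensor powers\<close>

locale k_algebra = vector_space scale
  for scale :: "'k::field \<Rightarrow> 'a::ring_1 \<Rightarrow> 'a" +
  assumes scale_mult_left: "scale c a * b = scale c (a * b)"
    and scale_mult_right: "a * scale c b = scale c (a * b)"

definition functional :: "('k::field \<Rightarrow> 'a::ring_1 \<Rightarrow> 'a) \<Rightarrow> ('a \<Rightarrow> 'k) \<Rightarrow> bool" where
  "functional scale f \<longleftrightarrow> Vector_Spaces.linear scale (*) f"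

definition bilinear_form :: "('k::field \<Rightarrow> 'a::ring_1 \<Rightarrow> 'a) \<Rightarrow> ('a \<Rightarrow> 'a \<Rightarrow> 'k) \<Rightarrow> bool" where
  "bilinear_form scale s \<longleftrightarrow>
     (\<forall>a. functional scale (s a)) \<and> (\<forall>b. functional scale (\<lambda>a. s a b))"

text \<open>
  An element of a tensor power of the algebra is given by a formal sum of pure tensors: a list of
  lists, the inner list \<open>[a\<^sub>1, \<dots>, a\<^sub>n]\<close> standing for \<open>a\<^sub>1 \<otimes> \<cdots> \<otimes> a\<^sub>n\<close> and the outer list for
  summation. Two formal sums denote the same tensor iff they are related by the following
  congruence, generated by commutativity of the sum, additivity in each factor and the
  balancing of scalars; the tensor power is the quotient by it.
\<close>

inductive tensor_eq :: "('k::field \<Rightarrow> 'a::ring_1 \<Rightarrow> 'a) \<Rightarrow> 'a list list \<Rightarrow> 'a list list \<Rightarrow> bool"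
  for scale :: "'k \<Rightarrow> 'a \<Rightarrow> 'a" where
  refl: "tensor_eq scale s s"
| sym: "tensor_eq scale s t \<Longrightarrow> tensor_eq scale t s"
| trans: "tensor_eq scale s t \<Longrightarrow> tensor_eq scale t u \<Longrightarrow> tensor_eq scale s u"
| append: "tensor_eq scale s s' \<Longrightarrow> tensor_eq scale t t' \<Longrightarrow> tensor_eq scale (s @ t) (s' @ t')"
| commute: "tensor_eq scale (s @ t) (t @ s)"
| zero: "tensor_eq scale [u @ [0] @ v] []"
| add: "tensor_eq scale [u @ [a + b] @ v] [u @ [a] @ v, u @ [b] @ v]"
| scalar: "tensor_eq scale [u @ [scale c a] @ v @ [b] @ w] [u @ [a] @ v @ [scale c b] @ w]"

section \<open>Bialgebras and Hopf algebras\<close>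

text \<open>
  The comultiplication returns a representing formal sum: \<open>\<Delta> a\<close> is a list of pairs whose sum
  \<open>\<Sum> a\<^sub>1 \<otimes> a\<^sub>2\<close> is the coproduct of \<open>a\<close>. Only its class under \<^const>\<open>tensor_eq\<close> matters, and
  Sweedler sums are sums over this list.
\<close>

locale bialgebra = k_algebra scale
  for scale :: "'k::field \<Rightarrow> 'a::ring_1 \<Rightarrow> 'a" +
  fixes \<Delta> :: "'a \<Rightarrow> ('a \<times> 'a) list" and \<epsilon> :: "'a \<Rightarrow> 'k"
  assumes comult_add:
      "tensor_eq scale [[a1, a2]. (a1, a2) \<leftarrow> \<Delta> (a + b)]
         ([[a1, a2]. (a1, a2) \<leftarrow> \<Delta> a] @ [[b1, b2]. (b1, b2) \<leftarrow> \<Delta> b])"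
    and comult_scale:
      "tensor_eq scale [[a1, a2]. (a1, a2) \<leftarrow> \<Delta> (scale c a)] [[scale c a1, a2]. (a1, a2) \<leftarrow> \<Delta> a]"
    and comult_one: "tensor_eq scale [[a1, a2]. (a1, a2) \<leftarrow> \<Delta> 1] [[1, 1]]"
    and comult_mult:
      "tensor_eq scale [[c1, c2]. (c1, c2) \<leftarrow> \<Delta> (a * b)]
         [[a1 * b1, a2 * b2]. (a1, a2) \<leftarrow> \<Delta> a, (b1, b2) \<leftarrow> \<Delta> b]"
    and coassoc:
      "tensor_eq scale [[b1, b2, a2]. (a1, a2) \<leftarrow> \<Delta> a, (b1, b2) \<leftarrow> \<Delta> a1]
         [[a1, b1, b2]. (a1, a2) \<leftarrow> \<Delta> a, (b1, b2) \<leftarrow> \<Delta> a2]"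
    and counit_functional: "functional scale \<epsilon>"
    and counit_one: "\<epsilon> 1 = 1"
    and counit_mult: "\<epsilon> (a * b) = \<epsilon> a * \<epsilon> b"
    and counit_left: "(\<Sum>(a1, a2)\<leftarrow>\<Delta> a. scale (\<epsilon> a1) a2) = a"
    and counit_right: "(\<Sum>(a1, a2)\<leftarrow>\<Delta> a. scale (\<epsilon> a2) a1) = a"

locale hopf_algebra = bialgebra scale \<Delta> \<epsilon>
  for scale :: "'k::field \<Rightarrow> 'a::ring_1 \<Rightarrow> 'a"
    and \<Delta> :: "'a \<Rightarrow> ('a \<times> 'a) list" and \<epsilon> :: "'a \<Rightarrow> 'k" +
  fixes S :: "'a \<Rightarrow> 'a"
  assumes antipode_linear: "Vector_Spaces.linear scale scale S"
    and antipode_left: "(\<Sum>(a1, a2)\<leftarrow>\<Delta> a. S a1 * a2) = scale (\<epsilon> a) 1"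
    and antipode_right: "(\<Sum>(a1, a2)\<leftarrow>\<Delta> a. a1 * S a2) = scale (\<epsilon> a) 1"

definition comult3 :: "('a \<Rightarrow> ('a \<times> 'a) list) \<Rightarrow> 'a \<Rightarrow> ('a \<times> 'a \<times> 'a) list" where
  "comult3 \<Delta> a = [(b1, b2, a2). (a1, a2) \<leftarrow> \<Delta> a, (b1, b2) \<leftarrow> \<Delta> a1]"

section \<open>Braidings and coribbon elements\<close>

definition dual_inverse ::
  "('k::field \<Rightarrow> 'a::ring_1 \<Rightarrow> 'a) \<Rightarrow> ('a \<Rightarrow> ('a \<times> 'a) list) \<Rightarrow> ('a \<Rightarrow> 'k)
     \<Rightarrow> ('a \<Rightarrow> 'k) \<Rightarrow> ('a \<Rightarrow> 'k) \<Rightarrow> bool" where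
  "dual_inverse scale \<Delta> \<epsilon> f g \<longleftrightarrow> functional scale g \<and>
     (\<forall>a. (\<Sum>(a1, a2)\<leftarrow>\<Delta> a. f a1 * g a2) = \<epsilon> a) \<and>
     (\<forall>a. (\<Sum>(a1, a2)\<leftarrow>\<Delta> a. g a1 * f a2) = \<epsilon> a)"

definition form_inverse ::
  "('k::field \<Rightarrow> 'a::ring_1 \<Rightarrow> 'a) \<Rightarrow> ('a \<Rightarrow> ('a \<times> 'a) list) \<Rightarrow> ('a \<Rightarrow> 'k)
     \<Rightarrow> ('a \<Rightarrow> 'a \<Rightarrow> 'k) \<Rightarrow> ('a \<Rightarrow> 'a \<Rightarrow> 'k) \<Rightarrow> bool" where
  "form_inverse scale \<Delta> \<epsilon> s t \<longleftrightarrow> bilinear_form scale t \<and>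
     (\<forall>a b. (\<Sum>(a1, a2)\<leftarrow>\<Delta> a. \<Sum>(b1, b2)\<leftarrow>\<Delta> b. s a1 b1 * t a2 b2) = \<epsilon> a * \<epsilon> b) \<and>
     (\<forall>a b. (\<Sum>(a1, a2)\<leftarrow>\<Delta> a. \<Sum>(b1, b2)\<leftarrow>\<Delta> b. t a1 b1 * s a2 b2) = \<epsilon> a * \<epsilon> b)"

text \<open>The convolution inverse \<open>\<sigma>\<^sup>-\<^sup>1\<close>; it is unique when it exists.\<close>

definition conv_inv ::
  "('k::field \<Rightarrow> 'a::ring_1 \<Rightarrow> 'a) \<Rightarrow> ('a \<Rightarrow> ('a \<times> 'a) list) \<Rightarrow> ('a \<Rightarrow> 'k)
     \<Rightarrow> ('a \<Rightarrow> 'a \<Rightarrow> 'k) \<Rightarrow> 'a \<Rightarrow> 'a \<Rightarrow> 'k" where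
  "conv_inv scale \<Delta> \<epsilon> \<sigma> = (THE t. form_inverse scale \<Delta> \<epsilon> \<sigma> t)"

definition braiding ::
  "('k::field \<Rightarrow> 'a::ring_1 \<Rightarrow> 'a) \<Rightarrow> ('a \<Rightarrow> ('a \<times> 'a) list) \<Rightarrow> ('a \<Rightarrow> 'k)
     \<Rightarrow> ('a \<Rightarrow> 'a \<Rightarrow> 'k) \<Rightarrow> bool" where
  "braiding scale \<Delta> \<epsilon> \<sigma> \<longleftrightarrow>
     bilinear_form scale \<sigma> \<and> (\<exists>t. form_inverse scale \<Delta> \<epsilon> \<sigma> t) \<and>
     (\<forall>x y. (\<Sum>(x1, x2)\<leftarrow>\<Delta> x. \<Sum>(y1, y2)\<leftarrow>\<Delta> y. scale (\<sigma> x1 y1) (x2 * y2)) =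
            (\<Sum>(x1, x2)\<leftarrow>\<Delta> x. \<Sum>(y1, y2)\<leftarrow>\<Delta> y. scale (\<sigma> x2 y2) (y1 * x1))) \<and>
     (\<forall>x y z. \<sigma> (x * y) z = (\<Sum>(z1, z2)\<leftarrow>\<Delta> z. \<sigma> x z1 * \<sigma> y z2)) \<and>
     (\<forall>x y z. \<sigma> x (y * z) = (\<Sum>(x1, x2)\<leftarrow>\<Delta> x. \<sigma> x1 z * \<sigma> x2 y))"

definition coribbon ::
  "('k::field \<Rightarrow> 'a::ring_1 \<Rightarrow> 'a) \<Rightarrow> ('a \<Rightarrow> ('a \<times> 'a) list) \<Rightarrow> ('a \<Rightarrow> 'k)
     \<Rightarrow> ('a \<Rightarrow> 'a \<Rightarrow> 'k) \<Rightarrow> ('a \<Rightarrow> 'k) \<Rightarrow> bool" where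
  "coribbon scale \<Delta> \<epsilon> \<sigma> \<theta> \<longleftrightarrow>
     functional scale \<theta> \<and> (\<exists>g. dual_inverse scale \<Delta> \<epsilon> \<theta> g) \<and>
     (\<forall>x. (\<Sum>(x1, x2)\<leftarrow>\<Delta> x. scale (\<theta> x1) x2) = (\<Sum>(x1, x2)\<leftarrow>\<Delta> x. scale (\<theta> x2) x1)) \<and>
     (\<forall>x y. \<theta> (x * y) =
        (\<Sum>(x1, x2, x3)\<leftarrow>comult3 \<Delta> x. \<Sum>(y1, y2, y3)\<leftarrow>comult3 \<Delta> y.
           conv_inv scale \<Delta> \<epsilon> \<sigma> x1 y1 * \<theta> x2 * \<theta> y2 * conv_inv scale \<Delta> \<epsilon> \<sigma> y3 x3)) \<and>
     \<theta> 1 = 1"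

definition hopf_coribbon ::
  "('k::field \<Rightarrow> 'a::ring_1 \<Rightarrow> 'a) \<Rightarrow> ('a \<Rightarrow> ('a \<times> 'a) list) \<Rightarrow> ('a \<Rightarrow> 'k)
     \<Rightarrow> ('a \<Rightarrow> 'a) \<Rightarrow> ('a \<Rightarrow> 'a \<Rightarrow> 'k) \<Rightarrow> ('a \<Rightarrow> 'k) \<Rightarrow> bool" where
  "hopf_coribbon scale \<Delta> \<epsilon> S \<sigma> \<theta> \<longleftrightarrow> coribbon scale \<Delta> \<epsilon> \<sigma> \<theta> \<and> \<theta> \<circ> S = \<theta>"

section \<open>Free algebras and presentations\<close>

text \<open>
  Words form a monoid under concatenation, written additively so that
  finitely supported functions on words carry the convolution product of
  \<^theory>\<open>HOL-Library.Poly_Mapping\<close>: \<open>'g word \<Rightarrow>\<^sub>0 'k\<close> is the free \<open>'k\<close>-algebra on \<open>'g\<close>.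
\<close>

datatype 'g word = Word (letters: "'g list")

instantiation word :: (type) monoid_add
begin

definition zero_word :: "'g word" where "zero_word = Word []"

definition plus_word :: "'g word \<Rightarrow> 'g word \<Rightarrow> 'g word" where
  "plus_word u v = Word (letters u @ letters v)"

instance
  by standard (simp_all add: zero_word_def plus_word_def)

end

definition gen :: "'g \<Rightarrow> 'g word \<Rightarrow>\<^sub>0 'k::ring_1" where
  "gen g = Poly_Mapping.single (Word [g]) 1"

definition const :: "'k::ring_1 \<Rightarrow> 'g word \<Rightarrow>\<^sub>0 'k" where
  "const c = Poly_Mapping.single 0 c"

definition free_eval ::
  "('k::field \<Rightarrow> 'a::ring_1 \<Rightarrow> 'a) \<Rightarrow> ('g \<Rightarrow> 'a) \<Rightarrow> ('g word \<Rightarrow>\<^sub>0 'k) \<Rightarrow> 'a" where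
  "free_eval scale e p =
     (\<Sum>w\<in>Poly_Mapping.keys p. scale (Poly_Mapping.lookup p w) (prod_list (map e (letters w))))"

inductive_set two_sided_ideal :: "'r::ring_1 set \<Rightarrow> 'r set" for R :: "'r set" where
  base: "r \<in> R \<Longrightarrow> r \<in> two_sided_ideal R"
| zero: "0 \<in> two_sided_ideal R"
| add: "p \<in> two_sided_ideal R \<Longrightarrow> q \<in> two_sided_ideal R \<Longrightarrow> p + q \<in> two_sided_ideal R"
| mult_left: "p \<in> two_sided_ideal R \<Longrightarrow> q * p \<in> two_sided_ideal R"
| mult_right: "p \<in> two_sided_ideal R \<Longrightarrow> p * q \<in> two_sided_ideal R"

text \<open>The algebra is generated by the elements \<open>e g\<close> subject to the relations \<open>r = 0\<close>, \<open>r \<in> R\<close>.\<close>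

definition presented_by ::
  "('k::field \<Rightarrow> 'a::ring_1 \<Rightarrow> 'a) \<Rightarrow> ('g \<Rightarrow> 'a) \<Rightarrow> ('g word \<Rightarrow>\<^sub>0 'k) set \<Rightarrow> bool" where
  "presented_by scale e R \<longleftrightarrow> k_algebra scale \<and>
     surj (free_eval scale e) \<and> {p. free_eval scale e p = 0} = two_sided_ideal R"

section \<open>Suzuki's Hopf algebra\<close>

text \<open>
  Indices \<open>1, 2\<close> are taken in the two-element type \<open>2\<close> of integers modulo 2 (where \<open>2 = 0\<close>),
  so that \<open>i - j \<noteq> l - m\<close> there is exactly incongruence modulo 2.
\<close>

primrec alternating :: "nat \<Rightarrow> 'r::monoid_mult \<Rightarrow> 'r \<Rightarrow> 'r" where
  "alternating 0 a b = 1"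
| "alternating (Suc m) a b = a * alternating m b a"

definition suzuki_relators ::
  "nat \<Rightarrow> nat \<Rightarrow> 'k::field \<Rightarrow> 'k \<Rightarrow> ((2 \<times> 2) word \<Rightarrow>\<^sub>0 'k) set" where
  "suzuki_relators N L \<nu> l =
     (let X = (\<lambda>i j. gen (i, j)) in
       {X 1 1 ^ 2 - X 2 2 ^ 2, X 1 2 ^ 2 - X 2 1 ^ 2} \<union>
       {X i j * X p q | i j p q. i - j \<noteq> p - q} \<union>
       {X 1 1 ^ (2 * N) + const \<nu> * X 1 2 ^ (2 * N) - 1} \<union>
       {alternating L (X 1 1) (X 2 2) - alternating L (X 2 2) (X 1 1),
        alternating L (X 2 1) (X 1 2) - const l * alternating L (X 1 2) (X 2 1)})"

text \<open>
  Since the \<open>x i j\<close> generate the algebra, \<open>\<Delta>\<close> (as a map into the tensor square), \<open>\<epsilon>\<close> and \<open>S\<close>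
  are determined by their values on them. The same holds for the two braidings below.
\<close>

definition suzuki_hopf_algebra ::
  "('k::field \<Rightarrow> 'a::ring_1 \<Rightarrow> 'a) \<Rightarrow> nat \<Rightarrow> nat \<Rightarrow> 'k \<Rightarrow> 'k \<Rightarrow> (2 \<Rightarrow> 2 \<Rightarrow> 'a)
     \<Rightarrow> ('a \<Rightarrow> ('a \<times> 'a) list) \<Rightarrow> ('a \<Rightarrow> 'k) \<Rightarrow> ('a \<Rightarrow> 'a) \<Rightarrow> bool" where
  "suzuki_hopf_algebra scale N L \<nu> l x \<Delta> \<epsilon> S \<longleftrightarrow>
     presented_by scale (\<lambda>(i, j). x i j) (suzuki_relators N L \<nu> l) \<and>
     hopf_algebra scale \<Delta> \<epsilon> S \<and>
     (\<forall>i j. tensor_eq scale [[a1, a2]. (a1, a2) \<leftarrow> \<Delta> (x i j)]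
              [[x i 1, x 1 j], [x i 2, x 2 j]]) \<and>
     (\<forall>i j. \<epsilon> (x i j) = (if i = j then 1 else 0)) \<and>
     (\<forall>i j. S (x i j) = x j i ^ (4 * N - 1))"

definition sigma_braiding ::
  "('k::field \<Rightarrow> 'a::ring_1 \<Rightarrow> 'a) \<Rightarrow> (2 \<Rightarrow> 2 \<Rightarrow> 'a) \<Rightarrow> ('a \<Rightarrow> ('a \<times> 'a) list) \<Rightarrow> ('a \<Rightarrow> 'k)
     \<Rightarrow> 'k \<Rightarrow> 'k \<Rightarrow> ('a \<Rightarrow> 'a \<Rightarrow> 'k) \<Rightarrow> bool" where
  "sigma_braiding scale x \<Delta> \<epsilon> \<alpha> \<beta> \<sigma> \<longleftrightarrow> braiding scale \<Delta> \<epsilon> \<sigma> \<and>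
     \<sigma> (x 1 2) (x 1 2) = \<alpha> \<and> \<sigma> (x 2 1) (x 2 1) = \<alpha> \<and>
     \<sigma> (x 1 2) (x 2 1) = \<beta> \<and> \<sigma> (x 2 1) (x 1 2) = \<beta> \<and>
     (\<forall>i j p q. (i, j, p, q) \<notin> {(1,2,1,2), (2,1,2,1), (1,2,2,1), (2,1,1,2)}
        \<longrightarrow> \<sigma> (x i j) (x p q) = 0)"

definition tau_braiding ::
  "('k::field \<Rightarrow> 'a::ring_1 \<Rightarrow> 'a) \<Rightarrow> (2 \<Rightarrow> 2 \<Rightarrow> 'a) \<Rightarrow> ('a \<Rightarrow> ('a \<times> 'a) list) \<Rightarrow> ('a \<Rightarrow> 'k)
     \<Rightarrow> 'k \<Rightarrow> 'k \<Rightarrow> 'k \<Rightarrow> ('a \<Rightarrow> 'a \<Rightarrow> 'k) \<Rightarrow> bool" where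
  "tau_braiding scale x \<Delta> \<epsilon> l \<gamma> \<delta> \<tau> \<longleftrightarrow> braiding scale \<Delta> \<epsilon> \<tau> \<and>
     \<tau> (x 1 1) (x 1 1) = \<gamma> \<and> \<tau> (x 2 2) (x 2 2) = \<gamma> \<and>
     \<tau> (x 1 1) (x 2 2) = \<delta> \<and> \<tau> (x 2 2) (x 1 1) = l * \<delta> \<and>
     (\<forall>i j p q. (i, j, p, q) \<notin> {(1,1,1,1), (2,2,2,2), (1,1,2,2), (2,2,1,1)}
        \<longrightarrow> \<tau> (x i j) (x p q) = 0)"

definition suzuki_C :: "('k::field \<Rightarrow> 'a::ring_1 \<Rightarrow> 'a) \<Rightarrow> (2 \<Rightarrow> 2 \<Rightarrow> 'a) \<Rightarrow> 'a set" where
  "suzuki_C scale x = module.span scale {x 1 1, x 1 2, x 2 1, x 2 2}"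

definition theta_on_C ::
  "('k::field \<Rightarrow> 'a::ring_1 \<Rightarrow> 'a) \<Rightarrow> (2 \<Rightarrow> 2 \<Rightarrow> 'a) \<Rightarrow> 'k \<Rightarrow> ('a \<Rightarrow> 'k) \<Rightarrow> bool" where
  "theta_on_C scale x \<omega> t \<longleftrightarrow>
     (\<forall>a\<in>suzuki_C scale x. \<forall>b\<in>suzuki_C scale x. t (a + b) = t a + t b) \<and>
     (\<forall>c. \<forall>a\<in>suzuki_C scale x. t (scale c a) = c * t a) \<and>
     (\<forall>i j. t (x i j) = (if i = j then \<omega> else 0))"

definition extends_theta ::
  "('k::field \<Rightarrow> 'a::ring_1 \<Rightarrow> 'a) \<Rightarrow> (2 \<Rightarrow> 2 \<Rightarrow> 'a) \<Rightarrow> 'k \<Rightarrow> ('a \<Rightarrow> 'k) \<Rightarrow> bool" where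
  "extends_theta scale x \<omega> \<theta> \<longleftrightarrow>
     (\<exists>t. theta_on_C scale x \<omega> t \<and> (\<forall>a\<in>suzuki_C scale x. \<theta> a = t a))"

end

theory Submission
  imports Defs
begin

text \<open>
  Take indices modulo two and put \<open>e(i, s) = x\<^bsub>i\<^sub>1,i\<^sub>1+s\<^esub> \<cdots> x\<^bsub>i\<^sub>n,i\<^sub>n+s\<^esub>\<close> for a
  nonempty word \<open>i\<close> and a degree \<open>s\<close>. Words mixing both degrees vanish and
  \<open>1 = e(1\<^bsup>2N\<^esup>, 0) + \<nu> e(1\<^bsup>2N\<^esup>, 1)\<close>, so these monomials span the algebra
  (\<open>xprod_induct\<close>). For the same reason the coproduct is short:
  \<open>\<Delta> e(i, s) = \<Sum>\<^sub>t e(i, t) \<otimes> e(i + t, s + t)\<close> with \<open>t\<close> ranging over two values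
  (\<open>sweedler_xprod\<close>), and every convolution identity becomes a sum of a few terms.

  On monomials both braidings have one-point support: for words of lengths \<open>m\<close> and \<open>n\<close>,
  \<open>\<sigma>(e(i, s), e(j, t))\<close> is some \<open>B i j \<noteq> 0\<close> if \<open>s = f n\<close> and \<open>t = f m\<close>, and zero otherwise,
  with \<open>f = 1\<close> for \<open>\<sigma>\<^sub>\<alpha>\<^sub>\<beta>\<close> and \<open>f = 0\<close> for \<open>\<tau>\<^sub>\<gamma>\<^sub>\<delta>\<close> (\<open>braiding_xprod\<close>). Hence \<open>\<sigma>\<^sup>-\<^sup>1\<close> is
  known on monomials, and the right-hand side of (CR2) collapses to the product of the two values
  of \<open>\<theta>\<close> divided by the double braiding. In both families the double braiding is
  \<open>\<kappa>\<^bsup>2mn\<^esup> W i W j / W (i j)\<close> for a weight \<open>W\<close> on words.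

  The generators \<open>x\<^sub>1\<^sub>2\<close> and \<open>x\<^sub>2\<^sub>1\<close> are linearly independent, so (CR1) forces a coribbon element to
  be \<open>\<omega> \<delta>\<^sub>i\<^sub>j\<close> on generators. By (CR2) and induction on the length it then vanishes in
  degree 1, and \<open>\<theta>(e(i, 0)) = c\<^sup>n \<kappa>\<^bsup>-n\<^sup>2\<^esup> W i\<close> with \<open>c\<close> a fixed nonzero multiple of \<open>\<omega>\<close>
  (\<open>coribbon_diagonal_values\<close>). The relation for the unit gives \<open>c\<^bsup>2N\<^esup> = 1\<close>. Conversely, if
  \<open>c\<^bsup>2N\<^esup> = 1\<close>, this formula respects every defining relation, hence defines a functional on the
  presented algebra, and it is a coribbon element (\<open>coribbon_exists\<close>). Finally \<open>S\<close> reverses a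
  word and appends squares, which multiplies the value by \<open>c\<^bsup>-2n\<^esup>\<close>; so (CR4) amounts to
  \<open>c\<^sup>2 = 1\<close>, which has two solutions because the characteristic is not 2.

  Since \<open>c\<close> is \<open>\<omega> \<beta>\<close> for \<open>\<sigma>\<^sub>\<alpha>\<^sub>\<beta>\<close> and \<open>\<omega> \<gamma>\<close> for \<open>\<tau>\<^sub>\<gamma>\<^sub>\<delta>\<close>, the theorem is
  \<open>coribbon_classification\<close> read for the two families.
\<close>

section \<open>Indices modulo two\<close>

lemma UNIV_mod2: "(UNIV::2 set) = {0, 1}"
proof -
  have "card (UNIV::2 set) = card {0, 1::2}" by simp
  then show ?thesis by (intro card_subset_eq[symmetric]) auto
qed

lemma mod2_cases: "(i::2) = 0 \<or> i = 1"
  using UNIV_mod2 by blast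

lemma sum_mod2: "(\<Sum>t\<in>(UNIV::2 set). f t) = f 0 + f 1"
  by (simp add: UNIV_mod2)

lemma add_self_mod2 [simp]: "(t::2) + t = 0"
proof -
  have "(2::2) = 0" by simp
  then show ?thesis by (metis mult_2 mult_zero_left)
qed

lemma two_mult_mod2 [simp]: "2 * (t::2) = 0"
  using add_self_mod2[of t] by (simp only: mult_2)

lemma add_cancel_mod2 [simp]: "(t::2) + (t + u) = u" "u + t + t = u"
  by (simp_all add: add.assoc[symmetric])

lemma diff_mod2 [simp]: "(a::2) - b = a + b"
  by (metis add_self_mod2 add_diff_cancel_right' add_cancel_mod2(2))

lemma add_eq_iff_mod2: "(a::2) + b = c \<longleftrightarrow> a = c + b"
  by (metis add_cancel_mod2(2))

section \<open>Sweedler sums\<close>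

text \<open>
  The scalar multiplication \<open>sc\<close> of the target is a parameter, so that one set of lemmas serves
  scalar-valued sums as in (CR2) and algebra-valued sums as in (CR1) and the antipode axioms.
\<close>

definition bilinear_map ::
  "('k::field \<Rightarrow> 'a::ring_1 \<Rightarrow> 'a) \<Rightarrow> ('k \<Rightarrow> 'v::ab_group_add \<Rightarrow> 'v) \<Rightarrow> ('a \<Rightarrow> 'a \<Rightarrow> 'v) \<Rightarrow> bool" where
  "bilinear_map scale sc B \<longleftrightarrow>
     (\<forall>a b c. B (a + b) c = B a c + B b c) \<and> (\<forall>a b c. B a (b + c) = B a b + B a c) \<and>
     (\<forall>k a b. B (scale k a) b = sc k (B a b)) \<and> (\<forall>k a b. B a (scale k b) = sc k (B a b))"

text \<open>
  The moves generating the congruence are exactly those that a bilinear map does not see.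
  Formal tensors with a number of factors other than two are sent to 0.
\<close>

lemma tensor_eq_sum_list:
  assumes B: "bilinear_map scale sc B" and eq: "tensor_eq scale s t"
  defines "h \<equiv> \<lambda>u. case u of [a, b] \<Rightarrow> B a b | _ \<Rightarrow> 0"
  shows "(\<Sum>u\<leftarrow>s. h u) = (\<Sum>u\<leftarrow>t. h u)"
  using eq
proof induction
  case (zero u v)
  have "B 0 a = 0" "B a 0 = 0" for a
    using B unfolding bilinear_map_def by (metis add_cancel_right_right)+
  then show ?case by (auto simp: h_def split: list.splits simp: append_eq_Cons_conv Cons_eq_append_conv)
next
  case (add u a b v)
  show ?case using B unfolding bilinear_map_def
    by (auto simp: h_def append_eq_Cons_conv Cons_eq_append_conv split: list.splits)
next
  case (scalar u c a v b w)
  show ?case using B unfolding bilinear_map_def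
    by (auto simp: h_def append_eq_Cons_conv Cons_eq_append_conv split: list.splits)
qed auto

lemma sum_list_concat_pairs:
  "(\<Sum>u\<leftarrow>concat (map F xs). h u) = (\<Sum>y\<leftarrow>xs. \<Sum>u\<leftarrow>F y. h u)"
  by (induction xs) auto

lemma tensor_eq_sweedler:
  assumes B: "bilinear_map scale sc B"
    and eq: "tensor_eq scale [[a1, a2]. (a1, a2) \<leftarrow> D] T"
  shows "(\<Sum>(a1, a2)\<leftarrow>D. B a1 a2) = (\<Sum>u\<leftarrow>T. case u of [a, b] \<Rightarrow> B a b | _ \<Rightarrow> 0)"
  using tensor_eq_sum_list[OF B eq] by (simp add: sum_list_concat_pairs case_prod_unfold o_def)

context bialgebra
begin

lemma sweedler_add:
  assumes "bilinear_map scale sc B"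
  shows "(\<Sum>(a1, a2)\<leftarrow>\<Delta> (a + b). B a1 a2) = (\<Sum>(a1, a2)\<leftarrow>\<Delta> a. B a1 a2) + (\<Sum>(a1, a2)\<leftarrow>\<Delta> b. B a1 a2)"
  by (subst tensor_eq_sweedler[OF assms comult_add]) (simp add: sum_list_concat_pairs case_prod_unfold o_def)

lemma sweedler_scale:
  assumes B: "bilinear_map scale sc B" and "module sc"
  shows "(\<Sum>(a1, a2)\<leftarrow>\<Delta> (scale c a). B a1 a2) = sc c (\<Sum>(a1, a2)\<leftarrow>\<Delta> a. B a1 a2)"
proof -
  interpret m: module sc by fact
  have eq: "B (scale k a) b = sc k (B a b)" for k a b
    using B unfolding bilinear_map_def by blast
  have "(\<Sum>(a1, a2)\<leftarrow>D. sc c (B a1 a2)) = sc c (\<Sum>(a1, a2)\<leftarrow>D. B a1 a2)" for D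
    by (induction D) (auto simp: m.scale_right_distrib)
  then show ?thesis
    by (subst tensor_eq_sweedler[OF B comult_scale]) (simp add: sum_list_concat_pairs case_prod_unfold o_def eq)
qed

lemma sweedler_mult:
  assumes "bilinear_map scale sc B"
  shows "(\<Sum>(c1, c2)\<leftarrow>\<Delta> (a * b). B c1 c2)
    = (\<Sum>(a1, a2)\<leftarrow>\<Delta> a. \<Sum>(b1, b2)\<leftarrow>\<Delta> b. B (a1 * b1) (a2 * b2))"
  by (subst tensor_eq_sweedler[OF assms comult_mult]) (simp add: sum_list_concat_pairs case_prod_unfold o_def)

lemma module_scale: "module scale" and module_mult: "module ((*) :: 'k \<Rightarrow> 'k \<Rightarrow> 'k)"
  by (unfold_locales) (auto simp: algebra_simps)

lemma functional_iff:
  "functional scale f \<longleftrightarrow> (\<forall>a b. f (a + b) = f a + f b) \<and> (\<forall>c a. f (scale c a) = c * f a)"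
proof -
  have "vector_space ((*) :: 'k \<Rightarrow> 'k \<Rightarrow> 'k)" by unfold_locales (auto simp: algebra_simps)
  then show ?thesis
    unfolding functional_def Vector_Spaces.linear_iff using vector_space_axioms by blast
qed

lemma functional_sweedler:
  assumes "bilinear_map scale (*) B"
  shows "functional scale (\<lambda>a. \<Sum>(a1, a2)\<leftarrow>\<Delta> a. B a1 a2)"
  unfolding functional_iff
  by (simp add: sweedler_add[OF assms] sweedler_scale[OF assms module_mult])

lemma functional_sum_list:
  "(\<And>y. functional scale (\<lambda>a. F y a)) \<Longrightarrow> functional scale (\<lambda>a. \<Sum>y\<leftarrow>ys. F y a)"
  unfolding functional_iff by (induction ys) (auto simp: algebra_simps)

lemma functional_0: "functional scale f \<Longrightarrow> f 0 = 0"
  unfolding functional_iff by (metis add_cancel_right_right)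

lemma bilinear_map_functionals:
  "(\<And>b. functional scale (\<lambda>a. B a b)) \<Longrightarrow> (\<And>a. functional scale (B a)) \<Longrightarrow> bilinear_map scale (*) B"
  unfolding functional_iff bilinear_map_def by blast

lemma functional_mult_left: "functional scale f \<Longrightarrow> functional scale (\<lambda>a. c * f a)"
  and functional_mult_right: "functional scale f \<Longrightarrow> functional scale (\<lambda>a. f a * c)"
  unfolding functional_iff by (auto simp: algebra_simps)

end

section \<open>Functionals on a presented algebra\<close>

definition free_functional :: "('g word \<Rightarrow> 'k::field) \<Rightarrow> ('g word \<Rightarrow>\<^sub>0 'k) \<Rightarrow> 'k" where
  "free_functional F p = (\<Sum>w\<in>Poly_Mapping.keys p. Poly_Mapping.lookup p w * F w)"

lemma free_functional_add: "free_functional F (p + q) = free_functional F p + free_functional F q"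
  unfolding free_functional_def
  by (rule setsum_keys_plus_distrib) (auto simp: algebra_simps)

lemma free_functional_single [simp]: "free_functional F (Poly_Mapping.single w c) = c * F w"
  by (simp add: free_functional_def)

lemma free_functional_diff: "free_functional F (p - q) = free_functional F p - free_functional F q"
  using free_functional_add[of F "p - q" q] by simp

lemma poly_mapping_single_induct:
  fixes p :: "'g \<Rightarrow>\<^sub>0 'k::comm_monoid_add"
  assumes "P 0" "\<And>w c. P (Poly_Mapping.single w c)" "\<And>p q. P p \<Longrightarrow> P q \<Longrightarrow> P (p + q)"
  shows "P p"
proof -
  have eq: "p = (\<Sum>w\<in>Poly_Mapping.keys p. Poly_Mapping.single w (Poly_Mapping.lookup p w))"
    by (rule poly_mapping_eqI)
       (auto simp: lookup_sum lookup_single when_def in_keys_iff sum.delta)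
  have "P (\<Sum>w\<in>I. Poly_Mapping.single w (Poly_Mapping.lookup p w))" for I
    by (induction I rule: infinite_finite_induct) (auto intro: assms)
  then show ?thesis by (subst eq)
qed

text \<open>
  The property that \<open>a * p * b\<close> is killed for all \<open>a\<close> and \<open>b\<close> is inherited along the closure
  rules of the ideal, and by linearity \<open>a\<close> and \<open>b\<close> may be taken to be words. So it suffices to test
  the relators with a word on either side.
\<close>

lemma free_functional_vanishes_on_ideal:
  assumes R: "\<And>r u v. r \<in> R \<Longrightarrow>
      free_functional F (Poly_Mapping.single u 1 * r * Poly_Mapping.single v 1) = 0"
    and p: "p \<in> two_sided_ideal R"
  shows "free_functional F p = 0"
proof -
  have single: "Poly_Mapping.single u c = Poly_Mapping.single 0 c * Poly_Mapping.single u 1"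
    "Poly_Mapping.single u c = Poly_Mapping.single u 1 * Poly_Mapping.single 0 c"
    for u :: "'a word" and c :: 'b
    by (simp_all add: mult_single)
  have scal: "free_functional F (Poly_Mapping.single 0 c * q) = c * free_functional F q"
    "free_functional F (q * Poly_Mapping.single 0 c) = c * free_functional F q" for c q
    by (induction q rule: poly_mapping_single_induct;
        simp add: free_functional_add algebra_simps mult_single;
        simp add: free_functional_def)+
  have "free_functional F (a * p * b) = 0" for a b
    using p
  proof (induction arbitrary: a b)
    case (base r)
    have 1: "free_functional F (Poly_Mapping.single u c * r * Poly_Mapping.single v d) = 0" for u c v d
    proof -
      have "Poly_Mapping.single u c * r * Poly_Mapping.single v d =
        Poly_Mapping.single 0 c * ((Poly_Mapping.single u 1 * r * Poly_Mapping.single v 1)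
           * Poly_Mapping.single 0 d)"
        using single[of u c] single[of v d] by (simp add: mult.assoc)
      then show ?thesis using R[OF base] by (simp only: scal) simp
    qed
    have 2: "free_functional F (Poly_Mapping.single u c * r * b) = 0" for u c
      by (induction b rule: poly_mapping_single_induct)
         (auto simp: 1 distrib_left free_functional_add, simp add: free_functional_def)
    show ?case
      by (induction a rule: poly_mapping_single_induct)
         (auto simp: 2 distrib_right free_functional_add, simp add: free_functional_def)
  next
    case zero
    then show ?case by (simp add: free_functional_def)
  next
    case (add p q)
    then show ?case by (simp add: algebra_simps free_functional_add)
  next
    case (mult_left p q)
    then show ?case by (metis mult.assoc)
  next
    case (mult_right p q)
    then show ?case by (metis mult.assoc)
  qed
  from this[of 1 1] show ?thesis by simp
qed

context k_algebra
begin

lemma free_eval_add: "free_eval scale e (p + q) = free_eval scale e p + free_eval scale e q"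
  unfolding free_eval_def
  by (rule setsum_keys_plus_distrib) (auto simp: scale_left_distrib)

lemma free_eval_single [simp]:
  "free_eval scale e (Poly_Mapping.single w c) = scale c (prod_list (map e (letters w)))"
  by (simp add: free_eval_def)

lemma free_eval_diff: "free_eval scale e (p - q) = free_eval scale e p - free_eval scale e q"
  using free_eval_add[of e "p - q" q] by simp

lemma free_eval_scale:
  "free_eval scale e (Poly_Mapping.single 0 c * p) = scale c (free_eval scale e p)"
  by (induction p rule: poly_mapping_single_induct;
      simp add: free_eval_add algebra_simps mult_single scale_right_distrib;
      simp add: free_eval_def)

text \<open>
  Two preimages of an element under evaluation differ by an element of the ideal, so a function on
  words that is compatible with the relators descends to the presented algebra.
\<close>

lemma presented_functional:
  assumes pres: "presented_by scale e R"
    and R: "\<And>r u v. r \<in> R \<Longrightarrow>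
      free_functional F (Poly_Mapping.single u 1 * r * Poly_Mapping.single v 1) = 0"
  shows "\<exists>f. (\<forall>a b. f (a + b) = f a + f b) \<and> (\<forall>c a. f (scale c a) = c * f a) \<and>
             (\<forall>w. f (prod_list (map e (letters w))) = F w)"
proof -
  define f where "f a = free_functional F (SOME p. free_eval scale e p = a)" for a
  have f_eval: "f (free_eval scale e p) = free_functional F p" for p
  proof -
    define q where "q = (SOME q. free_eval scale e q = free_eval scale e p)"
    have "free_eval scale e q = free_eval scale e p"
      unfolding q_def by (rule someI[of _ p]) simp
    then have "q - p \<in> two_sided_ideal R"
      using pres unfolding presented_by_def by (auto simp: free_eval_diff)
    then have "free_functional F (q - p) = 0"
      using free_functional_vanishes_on_ideal R by blast
    then show ?thesis by (simp add: f_def q_def free_functional_diff)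
  qed
  have surj: "\<exists>p. a = free_eval scale e p" for a
    using pres unfolding presented_by_def by (metis surjD)
  show ?thesis
  proof (intro exI[of _ f] conjI allI)
    fix a b
    obtain p q where "a = free_eval scale e p" "b = free_eval scale e q"
      using surj by blast
    then show "f (a + b) = f a + f b"
      by (metis f_eval free_eval_add free_functional_add)
  next
    fix c a
    obtain p where p: "a = free_eval scale e p" using surj by blast
    have "free_functional F (Poly_Mapping.single 0 c * p) = c * free_functional F p"
      by (induction p rule: poly_mapping_single_induct;
          simp add: free_functional_add algebra_simps mult_single;
          simp add: free_functional_def)
    then show "f (scale c a) = c * f a"
      by (metis p f_eval free_eval_scale)
  next
    fix w
    show "f (prod_list (map e (letters w))) = F w"
      using f_eval[of "Poly_Mapping.single w 1"] by simp
  qed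
qed

lemma presented_induct:
  assumes pres: "presented_by scale e R"
    and "\<And>ws. P (prod_list (map e ws))"
    and "\<And>a b. P a \<Longrightarrow> P b \<Longrightarrow> P (a + b)" and "\<And>c a. P a \<Longrightarrow> P (scale c a)"
  shows "P a"
proof -
  have P0: "P 0" using assms(4)[OF assms(2), of 0] by simp
  obtain p where p: "a = free_eval scale e p"
    using pres unfolding presented_by_def by (metis surjD)
  have "P (free_eval scale e p)"
  proof (induction p rule: poly_mapping_single_induct)
    case 1
    then show ?case using P0 by (simp add: free_eval_def)
  qed (auto simp: free_eval_add intro: assms)
  then show ?thesis by (simp add: p)
qed

end

section \<open>Monomials in Suzuki's Hopf algebra\<close>

text \<open>
  The definitions call the second index 2; the proofs work with the residues 0 and 1.
\<close>

lemma two_eq_zero_mod2: "(2::2) = 0"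
  by simp

text \<open>
  The index words of the alternating products \<open>\<chi>\<close>.
\<close>

primrec alt :: "nat \<Rightarrow> 'b \<Rightarrow> 'b \<Rightarrow> 'b list" where
  "alt 0 a b = []"
| "alt (Suc m) a b = a # alt m b a"

lemma length_alt [simp]: "length (alt m a b) = m"
  by (induction m arbitrary: a b) auto

lemma map_alt: "map f (alt m a b) = alt m (f a) (f b)"
  by (induction m arbitrary: a b) auto

lemma set_alt: "set (alt m a b) \<subseteq> {a, b}"
  by (induction m arbitrary: a b) auto

lemma alt_member: "m \<ge> 1 \<Longrightarrow> a \<in> set (alt m a b)"
  by (cases m) auto

lemma letters_plus [simp]: "letters (u + v) = letters u @ letters v"
  by (simp add: plus_word_def)

lemma word_plus: "Word u + Word v = Word (u @ v)"
  by (simp add: plus_word_def)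

lemma gen_power: "gen g ^ n = Poly_Mapping.single (Word (replicate n g)) 1"
  by (induction n) (auto simp: gen_def mult_single word_plus simp flip: zero_word_def single_one)

lemma gen_square: "gen g ^ 2 = Poly_Mapping.single (Word [g, g]) 1"
  by (simp only: gen_power) (simp add: numeral_2_eq_2)

lemma alternating_gen: "alternating m (gen a) (gen b) = Poly_Mapping.single (Word (alt m a b)) 1"
  by (induction m arbitrary: a b)
     (auto simp: gen_def mult_single word_plus simp flip: zero_word_def single_one)

text \<open>
  The monomial \<open>e(i, s)\<close>. At the empty word it is 1 in both degrees, which is why
  statements that distinguish degrees are restricted to nonempty words.
\<close>

definition xprod :: "(2 \<Rightarrow> 2 \<Rightarrow> 'a::ring_1) \<Rightarrow> 2 list \<Rightarrow> 2 \<Rightarrow> 'a" where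
  "xprod x is s = prod_list (map (\<lambda>i. x i (i + s)) is)"

lemma xprod_Nil [simp]: "xprod x [] s = 1"
  and xprod_Cons: "xprod x (i # is) s = x i (i + s) * xprod x is s"
  and xprod_append: "xprod x (is @ js) s = xprod x is s * xprod x js s"
  by (simp_all add: xprod_def)

lemma xprod_single [simp]: "xprod x [i] s = x i (i + s)"
  by (simp add: xprod_def)

definition shift :: "2 \<Rightarrow> 2 list \<Rightarrow> 2 list" where
  "shift t is = map (\<lambda>i. i + t) is"

lemma shift_simps [simp]:
  "shift t [] = []" "shift t (i # is) = (i + t) # shift t is"
  "shift t (is @ js) = shift t is @ shift t js"
  "shift t is = [] \<longleftrightarrow> is = []" "length (shift t is) = length is"
  "shift t (shift u is) = shift (u + t) is" "shift 0 is = is" "rev (shift t is) = shift t (rev is)"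
  by (auto simp: shift_def rev_map algebra_simps)

locale suzuki =
  fixes scale :: "'k::field \<Rightarrow> 'a::ring_1 \<Rightarrow> 'a"
    and N L :: nat and \<nu> l :: 'k
    and x :: "2 \<Rightarrow> 2 \<Rightarrow> 'a"
    and \<Delta> :: "'a \<Rightarrow> ('a \<times> 'a) list" and \<epsilon> :: "'a \<Rightarrow> 'k" and S :: "'a \<Rightarrow> 'a"
  assumes N: "N \<ge> 1" and L: "L \<ge> 2" and \<nu>: "\<nu> \<in> {1, -1}" and l: "l \<in> {1, -1}"
    and suzuki: "suzuki_hopf_algebra scale N L \<nu> l x \<Delta> \<epsilon> S"
begin

sublocale hopf_algebra scale \<Delta> \<epsilon> S
  using suzuki unfolding suzuki_hopf_algebra_def by blast

lemma presented: "presented_by scale (\<lambda>(i, j). x i j) (suzuki_relators N L \<nu> l)"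
  using suzuki unfolding suzuki_hopf_algebra_def by blast

text \<open>
  A functional supported in one degree \<open>s\<close> is the same as a function \<open>G\<close> of index words that is
  compatible with the relators: \<open>square\<close> and \<open>braid\<close> are the relations of equal letters and of
  alternating words, and \<open>unit\<close> is the inhomogeneous relation. The signs \<open>\<nu>\<close> and \<open>l\<close> occur in
  degree 1 only. The case of empty \<open>u\<close> and \<open>v\<close> in \<open>unit\<close> is what makes \<open>G []\<close> the value at 1.
\<close>

lemma xprod_functional:
  assumes square: "\<And>u v. G (u @ [1, 1] @ v) = G (u @ [0, 0] @ v)"
    and braid: "\<And>u v. G (u @ alt L 0 1 @ v) = (if s = 0 then 1 else l) * G (u @ alt L 1 0 @ v)"
    and unit: "\<And>u v. G (u @ v) = (if s = 0 then 1 else \<nu>) * G (u @ replicate (2 * N) 1 @ v)"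
  shows "\<exists>f. functional scale f \<and>
    (\<forall>i t. i \<noteq> [] \<longrightarrow> f (xprod x i t) = (if t = s then G i else 0)) \<and> f 1 = G []"
proof -
  define F where "F w = (if \<forall>p\<in>set (letters w). snd p = fst p + s then G (map fst (letters w)) else 0)"
    for w :: "(2 \<times> 2) word"
  have mult_expand: "Poly_Mapping.single u 1 * (p - q) * Poly_Mapping.single v 1 =
      Poly_Mapping.single u 1 * p * Poly_Mapping.single v 1
      - Poly_Mapping.single u 1 * q * Poly_Mapping.single v 1"
    "Poly_Mapping.single u 1 * (p + q) * Poly_Mapping.single v 1 =
      Poly_Mapping.single u 1 * p * Poly_Mapping.single v 1
      + Poly_Mapping.single u 1 * q * Poly_Mapping.single v 1"
    for u v :: "(2 \<times> 2) word" and p q :: "(2 \<times> 2) word \<Rightarrow>\<^sub>0 'k"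
    by (simp_all add: algebra_simps)
  have s: "s = 0 \<or> s = 1" by (rule mod2_cases)
  have alt_all: "(\<forall>p\<in>set (alt m a b). P p) \<longleftrightarrow> P a \<and> P b" if "m \<ge> 2" for m a b and P :: "2 \<times> 2 \<Rightarrow> bool"
    using that set_alt[of m a b] set_alt[of "m - 1" b a] alt_member[of m a b] alt_member[of "m - 1" b a]
    by (cases m) auto
  have "free_functional F (Poly_Mapping.single u 1 * r * Poly_Mapping.single v 1) = 0"
    if r: "r \<in> suzuki_relators N L \<nu> l" for r u v
  proof -
    define u' v' where "u' = map fst (letters u)" and "v' = map fst (letters v)"
    define ok where "ok \<longleftrightarrow> (\<forall>p\<in>set (letters u). snd p = fst p + s) \<and> (\<forall>p\<in>set (letters v). snd p = fst p + s)"
    have F: "F (u + Word w + v) =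
       (if ok \<and> (\<forall>p\<in>set w. snd p = fst p + s) then G (u' @ map fst w @ v') else 0)" for w
      by (auto simp: F_def u'_def v'_def ok_def)
    have FW: "free_functional F (Poly_Mapping.single u 1 * Poly_Mapping.single (Word w) c * Poly_Mapping.single v 1)
       = c * F (u + Word w + v)" for w c
      by (simp add: mult_single)
    have F1: "free_functional F (Poly_Mapping.single u 1 * Poly_Mapping.single v 1) = F (u + Word [] + v)"
      by (simp add: mult_single flip: zero_word_def)
    consider "r = gen (1,1) ^ 2 - gen (0,0) ^ 2" | "r = gen (1,0) ^ 2 - gen (0,1) ^ 2"
      | i j p q where "r = gen (i,j) * gen (p,q)" "i - j \<noteq> p - q"
      | "r = gen (1,1) ^ (2 * N) + const \<nu> * gen (1,0) ^ (2 * N) - 1"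
      | "r = alternating L (gen (1,1)) (gen (0,0)) - alternating L (gen (0,0)) (gen (1,1))"
      | "r = alternating L (gen (0,1)) (gen (1,0)) - const l * alternating L (gen (1,0)) (gen (0,1))"
      using r unfolding suzuki_relators_def Let_def two_eq_zero_mod2 by blast
    then show ?thesis
    proof cases
      case 1
      show ?thesis using s square[of u' v']
        by (auto simp: 1 gen_square mult_expand free_functional_diff FW F)
    next
      case 2
      show ?thesis using s square[of u' v']
        by (auto simp: 2 gen_square mult_expand free_functional_diff FW F)
    next
      case 3
      have "\<not> (j = i + s \<and> q = p + s)" using 3(2) by auto
      then show ?thesis
        by (auto simp: 3(1) gen_def mult_single word_plus F)
    next
      case 4
      have sng: "const \<nu> * Poly_Mapping.single w 1 = Poly_Mapping.single w \<nu>" for w :: "(2 \<times> 2) word"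
        by (simp add: const_def mult_single)
      show ?thesis using s unit[of u' v'] N
        by (auto simp: 4 gen_power mult_expand free_functional_diff free_functional_add FW F F1 sng)
    next
      case 5
      show ?thesis using s braid[of u' v'] L
        by (auto simp: 5 alternating_gen mult_expand free_functional_diff FW F alt_all map_alt)
    next
      case 6
      have sng: "const l * Poly_Mapping.single w 1 = Poly_Mapping.single w l" for w :: "(2 \<times> 2) word"
        by (simp add: const_def mult_single)
      show ?thesis using s braid[of u' v'] L
        by (auto simp: 6 alternating_gen mult_expand free_functional_diff FW F alt_all map_alt sng)
    qed
  qed
  from presented_functional[OF presented this] obtain f
    where f: "\<And>a b. f (a + b) = f a + f b" "\<And>c a. f (scale c a) = c * f a"
      and fw: "\<And>w. f (prod_list (map (\<lambda>(i, j). x i j) (letters w))) = F w"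
    by blast
  show ?thesis
  proof (intro exI[of _ f] conjI allI impI)
    show "functional scale f" unfolding functional_iff using f by blast
    fix i t assume "i \<noteq> ([]::2 list)"
    then have "F (Word (map (\<lambda>i. (i, i + t)) i)) = (if t = s then G i else 0)"
      by (cases i) (auto simp: F_def o_def)
    moreover have "xprod x i t = prod_list (map (\<lambda>(i, j). x i j) (letters (Word (map (\<lambda>i. (i, i + t)) i))))"
      by (simp add: xprod_def o_def)
    ultimately show "f (xprod x i t) = (if t = s then G i else 0)"
      using fw by metis
  next
    show "f 1 = G []" using fw[of "Word []"] by (simp add: F_def)
  qed
qed

lemma relation: "r \<in> suzuki_relators N L \<nu> l \<Longrightarrow> free_eval scale (\<lambda>(i, j). x i j) r = 0"
  using presented two_sided_ideal.base unfolding presented_by_def by blast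

lemma mixed_zero: "i + j \<noteq> p + q \<Longrightarrow> x i j * x p q = 0"
proof -
  assume "i + j \<noteq> p + q"
  then have "gen (i, j) * gen (p, q) \<in> suzuki_relators N L \<nu> l"
    unfolding suzuki_relators_def Let_def by auto
  from relation[OF this] show ?thesis
    by (simp add: gen_def mult_single word_plus)
qed

lemma squares: "x 1 1 * x 1 1 = x 0 0 * x 0 0" "x 1 0 * x 1 0 = x 0 1 * x 0 1"
proof -
  have "gen (1,1) ^ 2 - gen (0,0) ^ 2 \<in> suzuki_relators N L \<nu> l"
    "gen (1,0) ^ 2 - gen (0,1) ^ 2 \<in> suzuki_relators N L \<nu> l"
    unfolding suzuki_relators_def Let_def two_eq_zero_mod2 by auto
  from this[THEN relation] show "x 1 1 * x 1 1 = x 0 0 * x 0 0" "x 1 0 * x 1 0 = x 0 1 * x 0 1"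
    by (simp_all add: gen_square free_eval_diff)
qed

lemma unit: "1 = xprod x (replicate (2 * N) 1) 0 + scale \<nu> (xprod x (replicate (2 * N) 1) 1)"
proof -
  have "gen (1,1) ^ (2 * N) + const \<nu> * gen (1,0) ^ (2 * N) - 1 \<in> suzuki_relators N L \<nu> l"
    unfolding suzuki_relators_def Let_def two_eq_zero_mod2 by auto
  moreover have "free_eval scale (\<lambda>(i, j). x i j) 1 = 1"
    unfolding single_one[symmetric] free_eval_single by (simp add: zero_word_def)
  ultimately show ?thesis
    using relation[of "gen (1,1) ^ (2 * N) + const \<nu> * gen (1,0) ^ (2 * N) - 1"]
    by (simp add: gen_power free_eval_diff free_eval_add const_def mult_single xprod_def)
qed

lemma xprod_mult_zero:
  assumes "s \<noteq> t" "i \<noteq> []" "j \<noteq> []"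
  shows "xprod x i s * xprod x j t = 0"
proof -
  obtain i' a where i: "i = i' @ [a]" using assms(2) by (metis rev_exhaust)
  obtain b j' where j: "j = b # j'" using assms(3) by (cases j) auto
  have "xprod x i s * xprod x j t = xprod x i' s * (x a (a + s) * x b (b + t)) * xprod x j' t"
    by (simp add: i j xprod_append xprod_Cons mult.assoc)
  also have "x a (a + s) * x b (b + t) = 0"
    using assms(1) by (intro mixed_zero) simp
  finally show ?thesis by simp
qed

lemma xprod_mult:
  "i \<noteq> [] \<Longrightarrow> j \<noteq> [] \<Longrightarrow> xprod x i s * xprod x j t = (if s = t then xprod x (i @ j) s else 0)"
  by (simp add: xprod_mult_zero xprod_append)

text \<open>
  The unit is a combination of two nonempty monomials, so the empty word needs no case of its own.
\<close>

lemma xprod_induct: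
  assumes word: "\<And>i s. i \<noteq> [] \<Longrightarrow> P (xprod x i s)"
    and add: "\<And>a b. P a \<Longrightarrow> P b \<Longrightarrow> P (a + b)" and scl: "\<And>c a. P a \<Longrightarrow> P (scale c a)"
  shows "P a"
  using presented
proof (rule presented_induct)
  fix ws :: "(2 \<times> 2) list"
  have P0: "P 0" using scl[OF word[of "[0]" 0], of 0] by simp
  have "P 1"
    using N by (subst unit) (auto intro!: add scl word)
  moreover have "\<exists>t. prod_list (map (\<lambda>(i, j). x i j) ws) \<in> {0, xprod x (map fst ws) t}" if "ws \<noteq> []"
    using that
  proof (induction ws)
    case (Cons p ws)
    obtain a b where p: "p = (a, b)" by (cases p)
    have x: "x a b = xprod x [a] (a + b)" by simp
    show ?case
    proof (cases "ws = []")
      case False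
      then obtain t where "prod_list (map (\<lambda>(i, j). x i j) ws) \<in> {0, xprod x (map fst ws) t}"
        using Cons by blast
      moreover have "x a b * xprod x (map fst ws) t \<in> {0, xprod x (map fst (p # ws)) (a + b)}"
        using False unfolding x by (subst xprod_mult) (auto simp: p)
      ultimately show ?thesis by (auto simp: p)
    qed (auto simp: p x simp del: xprod_single intro!: exI[of _ "a + b"])
  qed simp
  ultimately show "P (prod_list (map (\<lambda>(i, j). x i j) ws))"
    using P0 word[of "map fst ws"] by (cases "ws = []") fastforce+
qed (use add scl in auto)

lemma functional_eqI:
  assumes "functional scale f" "functional scale g"
    and "\<And>i s. i \<noteq> [] \<Longrightarrow> f (xprod x i s) = g (xprod x i s)"
  shows "f = g"
proof
  fix a show "f a = g a"
    using assms(1,2) by (induction a rule: xprod_induct) (auto simp: assms(3) functional_iff)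
qed

text \<open>
  Multiplying out the coproducts of the letters gives an intermediate index for each letter, but a
  product of generators of different degrees vanishes, so all letters are shifted by the same \<open>t\<close>.
\<close>

lemma sweedler_xprod:
  assumes B: "bilinear_map scale sc B"
  shows "i \<noteq> [] \<Longrightarrow> (\<Sum>(a1, a2)\<leftarrow>\<Delta> (xprod x i s). B a1 a2)
    = (\<Sum>t\<in>UNIV. B (xprod x i t) (xprod x (shift t i) (s + t)))"
  using B
proof (induction i arbitrary: s B)
  case (Cons a i)
  have gen: "(\<Sum>(a1, a2)\<leftarrow>\<Delta> (x p q). C a1 a2) = C (x p 0) (x 0 q) + C (x p 1) (x 1 q)"
    if "bilinear_map scale sc C" for C p q
  proof -
    have "tensor_eq scale [[a1, a2]. (a1, a2) \<leftarrow> \<Delta> (x p q)] [[x p 1, x 1 q], [x p 0, x 0 q]]"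
      using suzuki unfolding suzuki_hopf_algebra_def two_eq_zero_mod2 by blast
    from tensor_eq_sweedler[OF that this] show ?thesis by simp
  qed
  have gen': "(\<Sum>(a1, a2)\<leftarrow>\<Delta> (x a (a + s)). C a1 a2) =
      (\<Sum>t\<in>UNIV. C (x a (a + t)) (x (a + t) (a + s)))"
    if "bilinear_map scale sc C" for C
    using mod2_cases[of a] by (auto simp: gen[OF that] sum_mod2)
  show ?case
  proof (cases "i = []")
    case True
    then show ?thesis using gen'[OF Cons.prems(2)] by (simp add: add.assoc)
  next
    case False
    have zero: "B 0 c = 0" "B c 0 = 0" for c
      using Cons.prems(2) unfolding bilinear_map_def by (metis add_cancel_right_right)+
    have inner: "bilinear_map scale sc (\<lambda>b1 b2. B (a1 * b1) (a2 * b2))" for a1 a2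
      using Cons.prems(2) unfolding bilinear_map_def
      by (auto simp: distrib_left scale_mult_right)
    have outer: "bilinear_map scale sc (\<lambda>a1 a2. B (a1 * b1) (a2 * b2))" for b1 b2
      using Cons.prems(2) unfolding bilinear_map_def
      by (auto simp: distrib_right scale_mult_left)
    have comm: "(\<Sum>(a1, a2)\<leftarrow>D. \<Sum>u\<in>U. h u a1 a2) = (\<Sum>u\<in>U. \<Sum>(a1, a2)\<leftarrow>D. h u a1 a2)"
      for D :: "('a \<times> 'a) list" and U :: "2 set" and h :: "2 \<Rightarrow> 'a \<Rightarrow> 'a \<Rightarrow> _"
      by (induction D) (auto simp: sum.distrib)
    have left: "x a (a + t) * xprod x i u = (if t = u then xprod x (a # i) t else 0)" for t u
      using xprod_mult[of "[a]" i t u] False by simp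
    have right: "x (a + t) (a + s) * xprod x (shift t i) (s + t) = xprod x (shift t (a # i)) (s + t)" for t
      by (simp add: xprod_Cons add_ac)
    have "(\<Sum>(a1, a2)\<leftarrow>\<Delta> (xprod x (a # i) s). B a1 a2) =
      (\<Sum>(a1, a2)\<leftarrow>\<Delta> (x a (a + s)). \<Sum>(b1, b2)\<leftarrow>\<Delta> (xprod x i s). B (a1 * b1) (a2 * b2))"
      unfolding xprod_Cons by (rule sweedler_mult[OF Cons.prems(2)])
    also have "\<dots> = (\<Sum>(a1, a2)\<leftarrow>\<Delta> (x a (a + s)). \<Sum>u\<in>UNIV. B (a1 * xprod x i u) (a2 * xprod x (shift u i) (s + u)))"
      by (simp add: Cons.IH[OF False inner])
    also have "\<dots> = (\<Sum>u\<in>UNIV. \<Sum>t\<in>UNIV. B (x a (a + t) * xprod x i u) (x (a + t) (a + s) * xprod x (shift u i) (s + u)))"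
      unfolding comm by (simp add: gen'[OF outer])
    also have "\<dots> = (\<Sum>u\<in>UNIV. \<Sum>t\<in>UNIV. if t = u then B (xprod x (a # i) u) (xprod x (shift u (a # i)) (s + u)) else 0)"
      by (intro sum.cong) (auto simp: left right zero simp del: shift_simps)
    finally show ?thesis by simp
  qed
qed simp

lemma counit_xprod: "\<epsilon> (xprod x i s) = (if s = 0 \<or> i = [] then 1 else 0)"
proof (induction i)
  case (Cons a i)
  have "\<epsilon> (x a (a + s)) = (if s = 0 then 1 else 0)"
    using suzuki unfolding suzuki_hopf_algebra_def by simp
  then show ?case using Cons by (simp add: xprod_Cons counit_mult)
qed (simp add: counit_one)

end

section \<open>The antipode on monomials\<close>

context suzuki
begin

lemma xprod_square: "xprod x (u @ [a, a] @ v) s = xprod x (u @ [1, 1] @ v) s"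
proof -
  have "x a (a + s) * x a (a + s) = x 1 (1 + s) * x 1 (1 + s)"
    using mod2_cases[of a] mod2_cases[of s] squares by auto
  then show ?thesis by (simp add: xprod_append xprod_Cons mult.assoc[symmetric])
qed

lemma xprod_even_block:
  "xprod x (u @ replicate (2 * k) a @ v) s = xprod x (u @ replicate (2 * k) 1 @ v) s"
proof (induction k arbitrary: u)
  case (Suc k)
  have r: "replicate (2 * Suc k) b = [b, b] @ replicate (2 * k) b" for b :: 2 by simp
  have "xprod x (u @ replicate (2 * Suc k) a @ v) s = xprod x (u @ [1, 1] @ replicate (2 * k) a @ v) s"
    unfolding r by (metis append.assoc xprod_square)
  also have "\<dots> = xprod x ((u @ [1, 1]) @ replicate (2 * k) a @ v) s" by simp
  also have "\<dots> = xprod x (u @ replicate (2 * Suc k) 1 @ v) s"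
    unfolding Suc.IH r by simp
  finally show ?case .
qed simp

text \<open>
  The square of a letter depends only on the degree, so it may be rewritten as a square of the
  letter to its left; in this way a palindrome collapses from the middle outwards.
\<close>

lemma xprod_palindrome:
  "xprod x (i @ replicate (2 * k) 1 @ rev i @ v) s = xprod x (replicate (2 * (k + length i)) 1 @ v) s"
proof (induction i arbitrary: k rule: rev_induct)
  case (snoc a i)
  have r: "[a] @ replicate (2 * k) a @ [a] = replicate (2 * Suc k) a"
    by (simp add: replicate_append_same)
  have "xprod x ((i @ [a]) @ replicate (2 * k) 1 @ rev (i @ [a]) @ v) s
      = xprod x ((i @ [a]) @ replicate (2 * k) a @ rev (i @ [a]) @ v) s"
    by (rule xprod_even_block[symmetric])
  also have "\<dots> = xprod x (i @ ([a] @ replicate (2 * k) a @ [a]) @ rev i @ v) s"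
    by simp
  also have "\<dots> = xprod x (i @ replicate (2 * Suc k) 1 @ rev i @ v) s"
    unfolding r by (rule xprod_even_block)
  also have "\<dots> = xprod x (replicate (2 * (Suc k + length i)) 1 @ v) s" by (rule snoc.IH)
  finally show ?case by simp
qed simp

text \<open>
  The two summands of the unit annihilate each other, so its powers are taken termwise.
\<close>

lemma unit_power:
  "1 = xprod x (replicate (2 * N * Suc k) 1) 0 + scale (\<nu> ^ Suc k) (xprod x (replicate (2 * N * Suc k) 1) 1)"
proof (induction k)
  case 0
  show ?case using unit by simp
next
  case (Suc k)
  let ?E = "\<lambda>k. xprod x (replicate (2 * N * k) 1)"
  have ne: "replicate (2 * N * Suc k) (1::2) \<noteq> []" "replicate (2 * N) (1::2) \<noteq> []" for k
    using N by auto
  have r: "replicate (2 * N) (1::2) @ replicate (2 * N * Suc k) 1 = replicate (2 * N * Suc (Suc k)) 1"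
    by (simp add: replicate_add[symmetric] algebra_simps)
  have "(1::'a) = 1 * 1" by simp
  also have "\<dots> = (xprod x (replicate (2 * N) 1) 0 + scale \<nu> (xprod x (replicate (2 * N) 1) 1)) *
      (?E (Suc k) 0 + scale (\<nu> ^ Suc k) (?E (Suc k) 1))"
    using Suc.IH unit by simp
  also have "\<dots> = ?E (Suc (Suc k)) 0 + scale (\<nu> ^ Suc (Suc k)) (?E (Suc (Suc k)) 1)"
    by (simp only: distrib_left distrib_right scale_mult_left scale_mult_right xprod_mult[OF ne(2) ne(1)] r)
       simp
  finally show ?case .
qed

text \<open>
  The right-hand side is a right convolution inverse of the identity on the monomials of the word,
  and \<open>S\<close> is a left inverse, so the two agree. The formula itself comes from \<open>S x\<^sub>a\<^sub>b = x\<^sub>b\<^sub>a\<^bsup>4N-1\<^esup>\<close>: each of the \<open>n\<close> letters contributes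
  \<open>2N - 1\<close> squares, and these are collected at the end of the reversed word.
\<close>

lemma antipode_xprod:
  assumes "i \<noteq> []"
  shows "S (xprod x i s) = xprod x (rev (shift s i) @ replicate (2 * ((2 * N - 1) * length i)) 1) s"
proof -
  define f where "f i s = xprod x (rev (shift s i) @ replicate (2 * ((2 * N - 1) * length i)) 1) s" for i s
  have right: "(\<Sum>t\<in>UNIV. xprod x i t * f (shift t i) (s + t)) = (if s = 0 then 1 else 0)"
    if "i \<noteq> []" for i s
  proof (cases "s = 0")
    case False
    then have "xprod x i t * f (shift t i) (s + t) = 0" for t
      unfolding f_def using that by (subst xprod_mult_zero) auto
    then show ?thesis using False by simp
  next
    case True
    (* Suc k = 2 * length i is even, so the sign nu ^ Suc k in unit_power is 1. *)
    define k where "k = 2 * length i - 1"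
    have len: "2 * length i + 2 * ((2 * N - 1) * length i) = 2 * N * Suc k" "even (Suc k)"
      using that N by (cases N; cases i; simp add: k_def algebra_simps)+
    have "xprod x i t * f (shift t i) (s + t) = xprod x (replicate (2 * N * Suc k) 1) t" for t
    proof -
      have "xprod x i t * f (shift t i) (s + t) =
          xprod x (i @ replicate (2 * 0) 1 @ rev i @ replicate (2 * ((2 * N - 1) * length i)) 1) t"
        by (simp add: f_def True xprod_append)
      also have "\<dots> = xprod x (replicate (2 * N * Suc k) 1) t"
        unfolding xprod_palindrome add_0 replicate_add[symmetric] len(1) by (rule HOL.refl)
      finally show ?thesis .
    qed
    moreover have "\<nu> ^ Suc k = 1" using len(2) \<nu> by (auto simp del: power_Suc)
    ultimately show ?thesis using unit_power[of k] True by (simp add: sum_mod2)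
  qed
  have S: "bilinear_map scale scale (\<lambda>a b. S a * b)"
    using antipode_linear unfolding Vector_Spaces.linear_iff bilinear_map_def
    by (simp add: distrib_left distrib_right scale_mult_left scale_mult_right)
  have left: "(\<Sum>t\<in>UNIV. S (xprod x i t) * xprod x (shift t i) (s + t)) = (if s = 0 then 1 else 0)" for s
    using antipode_left[of "xprod x i s"] sweedler_xprod[OF S assms, of s] assms
    by (simp add: counit_xprod)
  (* f = (S * id) * f = S * (id * f) = S, with * the convolution *)
  have "f i s = (\<Sum>w\<in>UNIV. (if w = 0 then 1 else 0) * f (shift w i) (s + w))"
    by (simp add: sum_mod2)
  also have "\<dots> = (\<Sum>w\<in>UNIV. \<Sum>u\<in>UNIV. S (xprod x i u) * (xprod x (shift u i) (w + u) * f (shift w i) (s + w)))"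
    by (simp only: left[symmetric] sum_distrib_right mult.assoc)
  also have "\<dots> = (\<Sum>u\<in>UNIV. S (xprod x i u) * (\<Sum>w\<in>UNIV. xprod x (shift u i) (w + u) * f (shift w i) (s + w)))"
    by (subst sum.swap) (simp only: sum_distrib_left)
  also have "\<dots> = (\<Sum>u\<in>UNIV. S (xprod x i u) * (if s + u = 0 then 1 else 0))"
  proof (rule sum.cong[OF HOL.refl])
    fix u
    have "(\<Sum>w\<in>UNIV. xprod x (shift u i) (w + u) * f (shift w i) (s + w))
        = (\<Sum>w\<in>UNIV. xprod x (shift u i) w * f (shift w (shift u i)) (s + u + w))"
      using mod2_cases[of u] by (auto simp: sum_mod2 add_ac)
    then show "S (xprod x i u) * (\<Sum>w\<in>UNIV. xprod x (shift u i) (w + u) * f (shift w i) (s + w))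
        = S (xprod x i u) * (if s + u = 0 then 1 else 0)"
      using right[of "shift u i" "s + u"] assms by simp
  qed
  also have "\<dots> = S (xprod x i s)"
    using mod2_cases[of s] by (auto simp: sum_mod2)
  finally show ?thesis by (simp add: f_def)
qed

end

section \<open>Braidings and triple coproducts on monomials\<close>

context suzuki
begin

lemma form_functional: "bilinear_form scale T \<Longrightarrow> functional scale (T a)"
  "bilinear_form scale T \<Longrightarrow> functional scale (\<lambda>a. T a b)"
  unfolding bilinear_form_def by auto

lemma forms_sweedler_xprod:
  assumes s: "bilinear_form scale T" and t: "bilinear_form scale U" and ne: "i \<noteq> []" "j \<noteq> []"
  shows "(\<Sum>(a1, a2)\<leftarrow>\<Delta> (xprod x i s). \<Sum>(b1, b2)\<leftarrow>\<Delta> (xprod x j t). T a1 b1 * U a2 b2) =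
    (\<Sum>p\<in>UNIV. \<Sum>q\<in>UNIV. T (xprod x i p) (xprod x j q) *
       U (xprod x (shift p i) (s + p)) (xprod x (shift q j) (t + q)))"
proof -
  have inner: "bilinear_map scale (*) (\<lambda>b1 b2. T a1 b1 * U a2 b2)" for a1 a2
    by (intro bilinear_map_functionals functional_mult_left[OF form_functional(1)[OF t]]
        functional_mult_right[OF form_functional(1)[OF s]])
  have outer: "bilinear_map scale (*) (\<lambda>a1 a2. \<Sum>(b1, b2)\<leftarrow>D. T a1 b1 * U a2 b2)" for D
    unfolding case_prod_unfold
    by (intro bilinear_map_functionals functional_sum_list functional_mult_left[OF form_functional(2)[OF t]]
        functional_mult_right[OF form_functional(2)[OF s]])
  show ?thesis
    by (subst sweedler_xprod[OF outer ne(1)], subst sweedler_xprod[OF inner ne(2)]) (rule HOL.refl)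
qed

text \<open>
  The multiplicativity axioms determine a braiding from its values on generators. Moving a letter
  past a word shifts every letter of that word by \<open>f\<close>, which explains the shifts in the recursions
  \<open>B1\<close> and \<open>B2\<close> and the parities of the lengths in the support.
\<close>

lemma braiding_xprod:
  assumes braid: "braiding scale \<Delta> \<epsilon> \<sigma>"
    and gens: "\<And>a b s t. \<sigma> (x a (a + s)) (x b (b + t)) = (if s = f \<and> t = f then B [a] [b] else 0)"
    and B1: "\<And>a i j. i \<noteq> [] \<Longrightarrow> j \<noteq> [] \<Longrightarrow> B (a # i) j = B [a] j * B i (shift f j)"
    and B2: "\<And>a b j. j \<noteq> [] \<Longrightarrow> B [a] (b # j) = B [a] j * B (shift (f * of_nat (length j)) [a]) [b]"
  shows "i \<noteq> [] \<Longrightarrow> j \<noteq> [] \<Longrightarrow> \<sigma> (xprod x i s) (xprod x j t) =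
    (if s = f * of_nat (length j) \<and> t = f * of_nat (length i) then B i j else 0)"
proof (induction i arbitrary: s t j)
  case (Cons a i)
  have bil: "bilinear_form scale \<sigma>"
    and left: "\<And>x y z. \<sigma> (x * y) z = (\<Sum>(z1, z2)\<leftarrow>\<Delta> z. \<sigma> x z1 * \<sigma> y z2)"
    and right: "\<And>x y z. \<sigma> x (y * z) = (\<Sum>(x1, x2)\<leftarrow>\<Delta> x. \<sigma> x1 z * \<sigma> x2 y)"
    using braid unfolding braiding_def by auto
  have bl: "bilinear_map scale (*) (\<lambda>z1 z2. \<sigma> y z1 * \<sigma> z z2)"
    and br: "bilinear_map scale (*) (\<lambda>x1 x2. \<sigma> x1 y * \<sigma> x2 z)" for y z
    by (intro bilinear_map_functionals functional_mult_left[OF form_functional(1)[OF bil]]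
        functional_mult_right[OF form_functional(1)[OF bil]] functional_mult_left[OF form_functional(2)[OF bil]]
        functional_mult_right[OF form_functional(2)[OF bil]])+
  have one: "\<sigma> (x a (a + s)) (xprod x j t) = (if s = f * of_nat (length j) \<and> t = f then B [a] j else 0)"
    if "j \<noteq> []" for a j s t
    using that
  proof (induction j arbitrary: a s t)
    case (Cons b j)
    show ?case
    proof (cases "j = []")
      case True
      then show ?thesis by (simp add: gens)
    next
      case False
      have "\<sigma> (x a (a + s)) (xprod x (b # j) t) =
          (\<Sum>(x1, x2)\<leftarrow>\<Delta> (xprod x [a] s). \<sigma> x1 (xprod x j t) * \<sigma> x2 (x b (b + t)))"
        by (simp add: xprod_Cons right)
      also have "\<dots> = (\<Sum>u\<in>UNIV. \<sigma> (x a (a + u)) (xprod x j t) * \<sigma> (x (a + u) (a + u + (s + u))) (x b (b + t)))"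
        by (subst sweedler_xprod[OF br]) simp_all
      also have "\<dots> = (\<Sum>u\<in>UNIV. if u = f * of_nat (length j)
          then (if t = f \<and> s + u = f then B [a] j * B [a + u] [b] else 0) else 0)"
        unfolding Cons.IH[OF False] gens by (intro sum.cong) auto
      also have "\<dots> = (if t = f \<and> s + f * of_nat (length j) = f then B [a] (b # j) else 0)"
        using B2[OF False, of a b] by simp
      also have "s + f * of_nat (length j) = f \<longleftrightarrow> s = f * of_nat (length (b # j))"
        by (subst add_eq_iff_mod2) (simp add: distrib_left add.commute)
      finally show ?thesis by auto
    qed
  qed simp
  show ?case
  proof (cases "i = []")
    case True
    then show ?thesis using one[OF Cons.prems(2)] by simp
  next
    case False
    have "\<sigma> (xprod x (a # i) s) (xprod x j t) =
        (\<Sum>u\<in>UNIV. \<sigma> (x a (a + s)) (xprod x j u) * \<sigma> (xprod x i s) (xprod x (shift u j) (t + u)))"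
      unfolding xprod_Cons left by (rule sweedler_xprod[OF bl Cons.prems(2)])
    also have "\<dots> = (\<Sum>u\<in>UNIV. if u = f then (if s = f * of_nat (length j) \<and> t + u = f * of_nat (length i)
         then B [a] j * B i (shift u j) else 0) else 0)"
      using Cons.prems(2) by (intro sum.cong) (auto simp: one Cons.IH[OF False])
    also have "\<dots> = (if s = f * of_nat (length j) \<and> t + f = f * of_nat (length i) then B (a # i) j else 0)"
      using B1[OF False Cons.prems(2)] by simp
    also have "t + f = f * of_nat (length i) \<longleftrightarrow> t = f * of_nat (length (a # i))"
      by (subst add_eq_iff_mod2) (simp add: distrib_left add.commute)
    finally show ?thesis .
  qed
qed simp

lemma comult3_sum:
  "(\<Sum>(x1, x2, x3)\<leftarrow>comult3 \<Delta> a. H x1 x2 x3) = (\<Sum>(a1, a2)\<leftarrow>\<Delta> a. \<Sum>(b1, b2)\<leftarrow>\<Delta> a1. H b1 b2 a2)"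
  by (simp add: comult3_def sum_list_concat_pairs case_prod_unfold o_def)

lemma comult3_bilinear:
  assumes "\<And>b c. functional scale (\<lambda>a. H a b c)" "\<And>a c. functional scale (\<lambda>b. H a b c)"
    "\<And>a b. functional scale (\<lambda>c. H a b c)"
  shows "bilinear_map scale (*) (\<lambda>a1 a2. \<Sum>(b1, b2)\<leftarrow>\<Delta> a1. H b1 b2 a2)"
proof (rule bilinear_map_functionals)
  fix c show "functional scale (\<lambda>a. \<Sum>(b1, b2)\<leftarrow>\<Delta> a. H b1 b2 c)"
    by (rule functional_sweedler) (rule bilinear_map_functionals; rule assms)
next
  fix a show "functional scale (\<lambda>c. \<Sum>(b1, b2)\<leftarrow>\<Delta> a. H b1 b2 c)"
    unfolding case_prod_unfold by (rule functional_sum_list) (rule assms)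
qed

lemma comult3_functional:
  assumes "\<And>b c. functional scale (\<lambda>a. H a b c)" "\<And>a c. functional scale (\<lambda>b. H a b c)"
    "\<And>a b. functional scale (\<lambda>c. H a b c)"
  shows "functional scale (\<lambda>a. \<Sum>(x1, x2, x3)\<leftarrow>comult3 \<Delta> a. H x1 x2 x3)"
  unfolding comult3_sum by (rule functional_sweedler[OF comult3_bilinear[OF assms]])

lemma comult3_xprod:
  assumes H: "\<And>b c. functional scale (\<lambda>a. H a b c)" "\<And>a c. functional scale (\<lambda>b. H a b c)"
    "\<And>a b. functional scale (\<lambda>c. H a b c)" and ne: "i \<noteq> []"
  shows "(\<Sum>(x1, x2, x3)\<leftarrow>comult3 \<Delta> (xprod x i s). H x1 x2 x3) =
    (\<Sum>t\<in>UNIV. \<Sum>u\<in>UNIV. H (xprod x i u) (xprod x (shift u i) (t + u)) (xprod x (shift t i) (s + t)))"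
proof -
  have "bilinear_map scale (*) (\<lambda>b1 b2. H b1 b2 c)" for c
    by (intro bilinear_map_functionals H)
  from sweedler_xprod[OF this ne] show ?thesis
    unfolding comult3_sum sweedler_xprod[OF comult3_bilinear[OF H] ne]
    by (intro sum.cong HOL.refl)
qed

end

section \<open>The signed letter count and independence of the off-diagonal generators\<close>

text \<open>
  The alternating sum \<open>\<Sum>\<^sub>a (-1)\<^sup>a s(i\<^sub>a)\<close> over the positions \<open>a = 0, 1, \<dots>\<close>, where the letter 1 has
  sign \<open>s = 1\<close> and the letter 0 has sign \<open>s = -1\<close>. It is made for the relations: adjacent equal
  letters cancel, and the two alternating words of length \<open>L\<close> have the extreme values \<open>L\<close>
  and \<open>-L\<close>.
\<close>

primrec sgn_count :: "2 list \<Rightarrow> int" where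
  "sgn_count [] = 0"
| "sgn_count (a # i) = (if a = 1 then 1 else -1) - sgn_count i"

lemma sgn_count_append: "sgn_count (i @ j) = sgn_count i + (-1) ^ length i * sgn_count j"
  by (induction i) auto

lemma sgn_count_replicate_even [simp]: "sgn_count (replicate (2 * k) a) = 0"
  by (induction k) auto

lemma sgn_count_alt: "sgn_count (alt m 1 0) = int m" "sgn_count (alt m 0 1) = - int m"
  by (induction m) auto

lemma sgn_count_shift: "sgn_count (shift t i) = (if t = 0 then sgn_count i else - sgn_count i)"
proof -
  have "sgn_count (shift 1 i) = - sgn_count i"
  proof (induction i)
    case (Cons a i)
    then show ?case using mod2_cases[of a] by auto
  qed simp
  then show ?thesis using mod2_cases[of t] by auto
qed

lemma sgn_count_rev: "sgn_count (rev i) = (if even (length i) then - sgn_count i else sgn_count i)"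
  by (induction i) (auto simp: sgn_count_append)

context suzuki
begin

text \<open>
  Exchanging the two alternating words changes the signed count by \<open>2L\<close>, and the unit relation
  changes the length by \<open>2N\<close>; a weight with the right quasi-periods absorbs the signs \<open>l\<close> and \<open>\<nu>\<close>.
\<close>

lemma off_diagonal_functional:
  assumes h: "\<And>d. h (d + 2 * int L) = l * h d"
  shows "\<exists>f. functional scale f \<and> (\<forall>i t. i \<noteq> [] \<longrightarrow>
     f (xprod x i t) = (if t = 1 then \<nu> ^ (length i div (2 * N)) * h (sgn_count i) else 0))"
proof -
  have ll: "l * (l * y) = y" for y using l by auto
  have nn: "\<nu> * (\<nu> * y) = y" for y using \<nu> by auto
  have h': "h d = l * h (d + 2 * int L)" for d by (simp add: h ll)
  have "\<exists>f. functional scale f \<and> (\<forall>i t. i \<noteq> [] \<longrightarrow>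
     f (xprod x i t) = (if t = 1 then \<nu> ^ (length i div (2 * N)) * h (sgn_count i) else 0)) \<and>
     f 1 = \<nu> ^ (length ([]::2 list) div (2 * N)) * h (sgn_count [])"
  proof (rule xprod_functional[where s = 1], goal_cases)
    case (1 u v)
    show ?case by (simp add: sgn_count_append)
  next
    case (2 u v)
    define X where "X = sgn_count u + (-1) ^ length u * ((-1) ^ L * sgn_count v)"
    have X: "sgn_count (u @ alt L 0 1 @ v) = X - (-1) ^ length u * int L"
      "sgn_count (u @ alt L 1 0 @ v) = X + (-1) ^ length u * int L"
      by (simp_all add: X_def sgn_count_append sgn_count_alt algebra_simps)
    have "h (X - (-1) ^ length u * int L) = l * h (X + (-1) ^ length u * int L)"
    proof (cases "even (length u)")
      case True
      then show ?thesis using h'[of "X - int L"] by (simp add: algebra_simps)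
    next
      case False
      then show ?thesis using h[of "X - int L"] by (simp add: algebra_simps)
    qed
    then show ?case unfolding X by (simp add: algebra_simps)
  next
    case (3 u v)
    have "(2 * N + n) div (2 * N) = Suc (n div (2 * N))" for n
      using N by (simp add: div_add_self1)
    from this[of "length (u @ v)"] have len: "length (u @ replicate (2 * N) (1::2) @ v) div (2 * N) = Suc (length (u @ v) div (2 * N))"
      by (simp add: add_ac)
    have cnt: "sgn_count (u @ replicate (2 * N) 1 @ v) = sgn_count (u @ v)"
      by (simp add: sgn_count_append)
    show ?case unfolding len cnt by (simp add: mult.assoc nn)
  qed
  then show ?thesis by blast
qed

text \<open>
  The two generators have signed counts \<open>1\<close> and \<open>-1\<close>. These differ modulo \<open>2L\<close> because \<open>L \<ge> 2\<close>, so
  a weight on residues can be 1 at one of them and 0 at the other.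
\<close>

lemma off_diagonal_independent:
  assumes eq: "scale p (x 0 1) = scale q (x 1 0)"
  shows "p = 0 \<and> q = 0"
proof -
  (* the indicator of the residue class of 1, with a factor l for each period *)
  define h where "h d = (if 2 * int L dvd d - 1 then if even ((d - 1) div (2 * int L)) then 1 else l else 0)" for d
  have L0: "2 * int L \<noteq> 0" using L by auto
  have ll: "l * l = 1" using l by auto
  have h: "h (d + 2 * int L) = l * h d" for d
  proof -
    have 1: "2 * int L dvd d + 2 * int L - 1 \<longleftrightarrow> 2 * int L dvd d - 1"
      by (metis add_diff_eq add.commute dvd_add_triv_left_iff)
    have "d + 2 * int L - 1 = (d - 1) + 2 * int L" by simp
    then have 2: "(d + 2 * int L - 1) div (2 * int L) = (d - 1) div (2 * int L) + 1"
      by (simp only: div_add_self2[OF L0])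
    show ?thesis unfolding h_def 1 2 by (auto simp: ll)
  qed
  have h1: "h 1 = 1" by (simp add: h_def)
  have hm1: "h (-1) = 0"
  proof -
    have "\<not> 2 * int L dvd 2"
    proof
      assume "2 * int L dvd 2"
      then have "2 * int L \<le> 2" by (rule zdvd_imp_le) simp
      then show False using L by simp
    qed
    then show ?thesis by (simp add: h_def)
  qed
  have g: "g (sgn_count [0]) * p = g (sgn_count [1]) * q" if per: "\<And>d. g (d + 2 * int L) = l * g d" for g
  proof -
    obtain f where f: "functional scale f" and
      fv: "\<And>i t. i \<noteq> [] \<Longrightarrow> f (xprod x i t) = (if t = 1 then \<nu> ^ (length i div (2 * N)) * g (sgn_count i) else 0)"
      using off_diagonal_functional[of g, OF per] by blast
    have "1 div (2 * N) = 0" using N by simp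
    then have "f (x 0 1) = g (sgn_count [0])" "f (x 1 0) = g (sgn_count [1])"
      using fv[of "[0]" 1] fv[of "[1]" 1] by simp_all
    moreover have "p * f (x 0 1) = q * f (x 1 0)"
      using arg_cong[OF eq, of f] f unfolding functional_iff by simp
    ultimately show ?thesis by (simp add: mult.commute)
  qed
  have "h (- (d + 2 * int L)) = l * h (- d)" for d
    using h[of "- d - 2 * int L"] ll by (simp add: mult.assoc[symmetric])
  then show ?thesis using g[of h] g[of "\<lambda>d. h (- d)"] h h1 hm1 by simp
qed

lemma extends_theta_iff:
  assumes "functional scale \<theta>"
  shows "extends_theta scale x \<omega> \<theta> \<longleftrightarrow> (\<forall>i j. \<theta> (x i j) = (if i = j then \<omega> else 0))"
proof
  assume "extends_theta scale x \<omega> \<theta>"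
  then obtain t where t: "theta_on_C scale x \<omega> t" "\<And>a. a \<in> suzuki_C scale x \<Longrightarrow> \<theta> a = t a"
    unfolding extends_theta_def by blast
  have "x i j \<in> suzuki_C scale x" for i j
    using mod2_cases[of i] mod2_cases[of j]
    unfolding suzuki_C_def two_eq_zero_mod2 by (auto intro: span_base)
  then show "\<forall>i j. \<theta> (x i j) = (if i = j then \<omega> else 0)"
    using t unfolding theta_on_C_def by simp
next
  assume "\<forall>i j. \<theta> (x i j) = (if i = j then \<omega> else 0)"
  then show "extends_theta scale x \<omega> \<theta>"
    using assms unfolding extends_theta_def theta_on_C_def functional_iff by blast
qed

end

section \<open>Coribbon elements of a braiding supported in one degree\<close>

text \<open>
  What the two families of braidings have in common. The braiding is supported in degrees that are
  multiples of \<open>f\<close>, with values \<open>B\<close>; the left factor in \<open>B_twist\<close>, without \<open>W\<close>, is the double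
  braiding of two words, so up to powers of \<open>\<kappa>\<close> the weight \<open>W\<close> is the inverse full twist of a
  word, normalised on the empty word. The remaining assumptions on \<open>W\<close> say that it is compatible
  with the relations of the algebra, with the coproduct and with the antipode.
\<close>

locale suzuki_braided = suzuki scale N L \<nu> l x \<Delta> \<epsilon> S
  for scale :: "'k::field \<Rightarrow> 'a::ring_1 \<Rightarrow> 'a" and N L :: nat and \<nu> l :: 'k and x :: "2 \<Rightarrow> 2 \<Rightarrow> 'a"
    and \<Delta> :: "'a \<Rightarrow> ('a \<times> 'a) list" and \<epsilon> :: "'a \<Rightarrow> 'k" and S :: "'a \<Rightarrow> 'a" +
  fixes \<sigma> :: "'a \<Rightarrow> 'a \<Rightarrow> 'k" and f :: 2 and B :: "2 list \<Rightarrow> 2 list \<Rightarrow> 'k" and \<kappa> :: 'k and W :: "2 list \<Rightarrow> 'k"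
  assumes braiding: "braiding scale \<Delta> \<epsilon> \<sigma>"
    and \<sigma>_xprod: "\<And>i j s t. i \<noteq> [] \<Longrightarrow> j \<noteq> [] \<Longrightarrow> \<sigma> (xprod x i s) (xprod x j t) =
      (if s = f * of_nat (length j) \<and> t = f * of_nat (length i) then B i j else 0)"
    and B_nz: "\<And>i j. B i j \<noteq> 0"
    and B_twist: "\<And>i j. B (shift (f * of_nat (length j)) i) (shift (f * of_nat (length i)) j) * B j i * W (i @ j)
      = \<kappa> ^ (2 * length i * length j) * W i * W j"
    and \<kappa>: "\<kappa> \<noteq> 0" "\<kappa> ^ (4 * N) = 1"
    and W_nz: "\<And>i. W i \<noteq> 0" and W_Nil: "W [] = 1"
    and W_shift: "\<And>t i. W (shift t i) = W i" and W_rev: "\<And>i. W (rev i) = W i"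
    and W_square: "\<And>u a v. W (u @ [a, a] @ v) = W (u @ v)"
    and W_alt: "\<And>u v. W (u @ alt L 0 1 @ v) = W (u @ alt L 1 0 @ v)"
begin

abbreviation "\<sigma>inv \<equiv> conv_inv scale \<Delta> \<epsilon> \<sigma>"

lemma \<sigma>_bilinear: "bilinear_form scale \<sigma>"
  using braiding unfolding braiding_def by blast

text \<open>
  In the double sum for \<open>\<sigma> * T = \<epsilon> \<otimes> \<epsilon>\<close> only one term meets the support of \<open>\<sigma>\<close>, and the equation
  can be solved for the value of \<open>T\<close> in that term.
\<close>

lemma inverse_xprod:
  assumes T: "form_inverse scale \<Delta> \<epsilon> \<sigma> T" and ne: "i \<noteq> []" "j \<noteq> []"
  shows "T (xprod x i s) (xprod x j t) =
    (if s = f * of_nat (length j) \<and> t = f * of_nat (length i)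
     then inverse (B (shift (f * of_nat (length j)) i) (shift (f * of_nat (length i)) j)) else 0)"
proof -
  define p where "p = f * of_nat (length j)"
  define q where "q = f * of_nat (length i)"
  have bil: "bilinear_form scale T" using T unfolding form_inverse_def by blast
  have "(\<Sum>u\<in>UNIV. \<Sum>v\<in>UNIV. \<sigma> (xprod x (shift p i) u) (xprod x (shift q j) v) *
       T (xprod x (shift u (shift p i)) (s + p + u)) (xprod x (shift v (shift q j)) (t + q + v)))
     = \<epsilon> (xprod x (shift p i) (s + p)) * \<epsilon> (xprod x (shift q j) (t + q))"
    using T ne unfolding form_inverse_def
    by (subst forms_sweedler_xprod[OF \<sigma>_bilinear bil, symmetric]) auto
  also have "(\<Sum>u\<in>UNIV. \<Sum>v\<in>UNIV. \<sigma> (xprod x (shift p i) u) (xprod x (shift q j) v) *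
       T (xprod x (shift u (shift p i)) (s + p + u)) (xprod x (shift v (shift q j)) (t + q + v)))
     = B (shift p i) (shift q j) * T (xprod x i s) (xprod x j t)"
    using ne mod2_cases[of p] mod2_cases[of q]
    by (auto simp: \<sigma>_xprod p_def[symmetric] q_def[symmetric] sum_mod2)
  finally have "B (shift p i) (shift q j) * T (xprod x i s) (xprod x j t) = (if s = p \<and> t = q then 1 else 0)"
    using ne by (auto simp: counit_xprod add_eq_iff_mod2)
  then show ?thesis
    using B_nz[of "shift p i" "shift q j"] unfolding p_def[symmetric] q_def[symmetric]
    by (auto simp: field_simps split: if_splits)
qed

text \<open>
  The values on monomials are forced, and this is the uniqueness that makes the definite
  description in the definition of the inverse denote.
\<close>

lemma form_inverse_\<sigma>inv: "form_inverse scale \<Delta> \<epsilon> \<sigma> \<sigma>inv"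
proof -
  obtain T where T: "form_inverse scale \<Delta> \<epsilon> \<sigma> T"
    using braiding unfolding braiding_def by blast
  show ?thesis unfolding conv_inv_def
  proof (rule theI[of _ T])
    fix U assume U: "form_inverse scale \<Delta> \<epsilon> \<sigma> U"
    have bil: "bilinear_form scale T" "bilinear_form scale U"
      using T U unfolding form_inverse_def by auto
    have "U (xprod x i s) = T (xprod x i s)" if "i \<noteq> []" for i s
      using that by (intro functional_eqI form_functional bil) (simp add: inverse_xprod[OF T] inverse_xprod[OF U])
    then have "(\<lambda>a. U a b) = (\<lambda>a. T a b)" for b
      by (intro functional_eqI form_functional(2) bil) simp
    then show "U = T" by (metis ext)
  qed (rule T)
qed

lemma \<sigma>inv_bilinear: "bilinear_form scale \<sigma>inv"
  using form_inverse_\<sigma>inv unfolding form_inverse_def by blast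

lemmas \<sigma>inv_xprod = inverse_xprod[OF form_inverse_\<sigma>inv]

text \<open>
  The right-hand side of (CR2).
\<close>

definition twisted_product :: "('a \<Rightarrow> 'k) \<Rightarrow> 'a \<Rightarrow> 'a \<Rightarrow> 'k" where
  "twisted_product \<theta> a b = (\<Sum>(x1, x2, x3)\<leftarrow>comult3 \<Delta> a. \<Sum>(y1, y2, y3)\<leftarrow>comult3 \<Delta> b.
     \<sigma>inv x1 y1 * \<theta> x2 * \<theta> y2 * \<sigma>inv y3 x3)"

lemma twisted_product_rules:
  assumes \<theta>: "functional scale \<theta>"
  shows "functional scale (\<lambda>a. twisted_product \<theta> a b)" "functional scale (twisted_product \<theta> a)"
    and "i \<noteq> [] \<Longrightarrow> j \<noteq> [] \<Longrightarrow> twisted_product \<theta> (xprod x i s) (xprod x j t) =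
     (\<Sum>p\<in>UNIV. \<Sum>u\<in>UNIV. \<Sum>q\<in>UNIV. \<Sum>v\<in>UNIV.
        \<sigma>inv (xprod x i u) (xprod x j v) * \<theta> (xprod x (shift u i) (p + u)) * \<theta> (xprod x (shift v j) (q + v))
        * \<sigma>inv (xprod x (shift q j) (t + q)) (xprod x (shift p i) (s + p)))"
proof -
  note f1 = form_functional(1)[OF \<sigma>inv_bilinear] and f2 = form_functional(2)[OF \<sigma>inv_bilinear]
  let ?H = "\<lambda>x1 x2 x3 y1 y2 y3. \<sigma>inv x1 y1 * \<theta> x2 * \<theta> y2 * \<sigma>inv y3 x3"
  have H: "functional scale (\<lambda>z. ?H z x2 x3 y1 y2 y3)" "functional scale (\<lambda>z. ?H x1 z x3 y1 y2 y3)"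
    "functional scale (\<lambda>z. ?H x1 x2 z y1 y2 y3)" "functional scale (\<lambda>z. ?H x1 x2 x3 z y2 y3)"
    "functional scale (\<lambda>z. ?H x1 x2 x3 y1 z y3)" "functional scale (\<lambda>z. ?H x1 x2 x3 y1 y2 z)"
    for x1 x2 x3 y1 y2 y3
    using \<theta> f1 f2 unfolding functional_iff by (auto simp: algebra_simps)
  have K: "functional scale (\<lambda>z. \<Sum>(y1, y2, y3)\<leftarrow>D. ?H z x2 x3 y1 y2 y3)"
    "functional scale (\<lambda>z. \<Sum>(y1, y2, y3)\<leftarrow>D. ?H x1 z x3 y1 y2 y3)"
    "functional scale (\<lambda>z. \<Sum>(y1, y2, y3)\<leftarrow>D. ?H x1 x2 z y1 y2 y3)" for x1 x2 x3 D
    unfolding case_prod_unfold by (rule functional_sum_list, rule H)+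
  show "functional scale (\<lambda>a. twisted_product \<theta> a b)"
    unfolding twisted_product_def by (rule comult3_functional) (rule K)+
  show "functional scale (twisted_product \<theta> a)"
    unfolding twisted_product_def
    by (subst case_prod_unfold, rule functional_sum_list, subst case_prod_unfold, rule comult3_functional) (rule H)+
  show "twisted_product \<theta> (xprod x i s) (xprod x j t) =
     (\<Sum>p\<in>UNIV. \<Sum>u\<in>UNIV. \<Sum>q\<in>UNIV. \<Sum>v\<in>UNIV.
        ?H (xprod x i u) (xprod x (shift u i) (p + u)) (xprod x (shift p i) (s + p))
           (xprod x j v) (xprod x (shift v j) (q + v)) (xprod x (shift q j) (t + q)))"
    if "i \<noteq> []" "j \<noteq> []"
    unfolding twisted_product_def
    by (subst comult3_xprod[OF K that(1)], unfold comult3_xprod[OF H(4-6) that(2)]) (rule HOL.refl)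
qed

text \<open>
  Of the sixteen summands only one lies in the supports of both factors \<open>\<sigma>inv\<close> and of \<open>\<theta>\<close>, and
  there the two factors \<open>\<sigma>inv\<close> multiply to the inverse of the double braiding. The coproduct
  shifts the words on which \<open>\<theta>\<close> is evaluated, hence the assumptions on all shifts.
\<close>

lemma twisted_product_xprod:
  assumes \<theta>: "functional scale \<theta>" and ne: "i \<noteq> []" "j \<noteq> []"
    and i: "\<And>t r. \<theta> (xprod x (shift t i) r) = (if r = 0 then g else 0)"
    and j: "\<And>t r. \<theta> (xprod x (shift t j) r) = (if r = 0 then h else 0)"
  shows "twisted_product \<theta> (xprod x i s) (xprod x j t) =
    (if s = 0 \<and> t = 0 then g * h * W (i @ j) / (\<kappa> ^ (2 * length i * length j) * W i * W j) else 0)"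
proof -
  define p0 where "p0 = f * of_nat (length j)"
  define q0 where "q0 = f * of_nat (length i)"
  define V where "V = inverse (B (shift p0 i) (shift q0 j)) * g * h * inverse (B j i)"
  have "twisted_product \<theta> (xprod x i s) (xprod x j t) =
     (\<Sum>p\<in>UNIV. \<Sum>u\<in>UNIV. \<Sum>q\<in>UNIV. \<Sum>v\<in>UNIV.
       if p = p0 \<and> u = p0 \<and> q = q0 \<and> v = q0 \<and> s = 0 \<and> t = 0 then V else 0)"
    unfolding twisted_product_rules(3)[OF \<theta> ne] using ne
    by (intro sum.cong HOL.refl)
       (auto simp: \<sigma>inv_xprod i j p0_def[symmetric] q0_def[symmetric] V_def add_eq_iff_mod2)
  also have "\<dots> = (if s = 0 \<and> t = 0 then V else 0)"
    using mod2_cases[of p0] mod2_cases[of q0] by (auto simp: sum_mod2)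
  also have "V = g * h * W (i @ j) / (B (shift p0 i) (shift q0 j) * B j i * W (i @ j))"
    unfolding V_def using B_nz W_nz by (simp add: field_simps)
  also have "B (shift p0 i) (shift q0 j) * B j i * W (i @ j) = \<kappa> ^ (2 * length i * length j) * W i * W j"
    unfolding p0_def q0_def by (rule B_twist)
  finally show ?thesis .
qed

text \<open>
  The exponent of \<open>\<kappa>\<close> is quadratic because the factor \<open>\<kappa>\<^bsup>-2mn\<^esup>\<close> from the double braiding is the
  cross term of \<open>(m + n)\<^sup>2\<close>.
\<close>

definition ribbon_value :: "'k \<Rightarrow> 2 list \<Rightarrow> 'k" where
  "ribbon_value c i = c ^ length i * inverse \<kappa> ^ (length i)\<^sup>2 * W i"

lemma ribbon_value_append:
  "ribbon_value c i * ribbon_value c j * W (i @ j) / (\<kappa> ^ (2 * length i * length j) * W i * W j)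
    = ribbon_value c (i @ j)"
proof -
  have "(length (i @ j))\<^sup>2 = (length i)\<^sup>2 + (length j)\<^sup>2 + 2 * length i * length j"
    by (simp add: power2_eq_square algebra_simps)
  then show ?thesis
    unfolding ribbon_value_def using W_nz[of i] W_nz[of j] \<kappa>(1)
    by (simp add: power_add field_simps)
qed

lemma ribbon_value_shift: "ribbon_value c (shift t i) = ribbon_value c i"
  by (simp add: ribbon_value_def W_shift)

lemma W_even_block: "W (u @ replicate (2 * k) a @ v) = W (u @ v)"
proof (induction k)
  case (Suc k)
  have "W (u @ replicate (2 * Suc k) a @ v) = W (u @ [a, a] @ replicate (2 * k) a @ v)" by simp
  then show ?case unfolding W_square using Suc by simp
qed simp

definition diagonal_values :: "'k \<Rightarrow> ('a \<Rightarrow> 'k) \<Rightarrow> bool" where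
  "diagonal_values c \<theta> \<longleftrightarrow>
     (\<forall>i s. i \<noteq> [] \<longrightarrow> \<theta> (xprod x i s) = (if s = 0 then ribbon_value c i else 0))"

lemma \<kappa>_power: "inverse \<kappa> ^ (n + 4 * N * k) = inverse \<kappa> ^ n"
  using \<kappa> by (simp add: power_add power_mult power_inverse)

lemma ribbon_value_unit:
  assumes "c ^ (2 * N) = 1"
  shows "ribbon_value c (u @ replicate (2 * N) 1 @ v) = ribbon_value c (u @ v)"
proof -
  let ?n = "length (u @ v)"
  have len: "length (u @ replicate (2 * N) (1::2) @ v) = ?n + 2 * N" by simp
  have sq: "(?n + 2 * N)\<^sup>2 = ?n\<^sup>2 + 4 * N * (?n + N)"
    by (simp add: power2_eq_square algebra_simps)
  show ?thesis
    unfolding ribbon_value_def len sq \<kappa>_power W_even_block by (simp add: power_add assms)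
qed

lemma ribbon_functional:
  assumes "\<And>u v. R (u @ [1, 1] @ v) = R (u @ [0, 0] @ v)"
    "\<And>u v. R (u @ alt L 0 1 @ v) = R (u @ alt L 1 0 @ v)"
    "\<And>u v. R (u @ replicate (2 * N) 1 @ v) = R (u @ v)"
  shows "\<exists>\<theta>. functional scale \<theta> \<and> (\<forall>i s. i \<noteq> [] \<longrightarrow> \<theta> (xprod x i s) = (if s = 0 then R i else 0)) \<and> \<theta> 1 = R []"
  by (rule xprod_functional) (simp_all only: assms, simp_all)

lemma ribbon_value_relations:
  assumes "c ^ (2 * N) = 1"
  shows "ribbon_value c (u @ [1, 1] @ v) = ribbon_value c (u @ [0, 0] @ v)"
    "ribbon_value c (u @ alt L 0 1 @ v) = ribbon_value c (u @ alt L 1 0 @ v)"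
    "ribbon_value c (u @ replicate (2 * N) 1 @ v) = ribbon_value c (u @ v)"
proof -
  show "ribbon_value c (u @ [1, 1] @ v) = ribbon_value c (u @ [0, 0] @ v)"
    unfolding ribbon_value_def W_square by simp
  show "ribbon_value c (u @ alt L 0 1 @ v) = ribbon_value c (u @ alt L 1 0 @ v)"
    unfolding ribbon_value_def W_alt by simp
qed (rule ribbon_value_unit[OF assms])

text \<open>
  For functionals supported in degree 0 the convolution product is the pointwise product on
  monomials.
\<close>

lemma diagonal_dual_inverse:
  assumes \<theta>: "functional scale \<theta>" and g: "functional scale g"
    and \<theta>v: "\<And>i s. i \<noteq> [] \<Longrightarrow> \<theta> (xprod x i s) = (if s = 0 then R i else 0)"
    and gv: "\<And>i s. i \<noteq> [] \<Longrightarrow> g (xprod x i s) = (if s = 0 then inverse (R i) else 0)"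
    and nz: "\<And>i. R i \<noteq> 0"
  shows "dual_inverse scale \<Delta> \<epsilon> \<theta> g"
proof -
  have bil: "bilinear_map scale (*) (\<lambda>a1 a2. \<theta> a1 * g a2)" "bilinear_map scale (*) (\<lambda>a1 a2. g a1 * \<theta> a2)"
    using \<theta> g unfolding functional_iff bilinear_map_def by (auto simp: algebra_simps)
  have "(\<lambda>a. \<Sum>(a1, a2)\<leftarrow>\<Delta> a. \<theta> a1 * g a2) = \<epsilon>" "(\<lambda>a. \<Sum>(a1, a2)\<leftarrow>\<Delta> a. g a1 * \<theta> a2) = \<epsilon>"
    by (intro functional_eqI functional_sweedler bil counit_functional;
        simp add: sweedler_xprod[OF bil(1)] sweedler_xprod[OF bil(2)] sum_mod2 \<theta>v gv counit_xprod nz)+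
  then show ?thesis unfolding dual_inverse_def using g by (auto simp: fun_eq_iff)
qed

text \<open>
  On monomials, (CR1) is the invariance of the values under shifts, (CR2) is
  \<open>ribbon_value_append\<close>, and (CR3) is the normalisation of \<open>W\<close>.
\<close>

lemma coribbon_exists:
  assumes c: "c ^ (2 * N) = 1"
  shows "\<exists>\<theta>. coribbon scale \<Delta> \<epsilon> \<sigma> \<theta> \<and> diagonal_values c \<theta>"
proof -
  have c0: "c \<noteq> 0" using c N by (auto simp: power_0_left)
  then have nz: "ribbon_value c i \<noteq> 0" for i
    unfolding ribbon_value_def using W_nz \<kappa> by simp
  obtain \<theta> where \<theta>: "functional scale \<theta>" and one: "\<theta> 1 = ribbon_value c []"
    and \<theta>v: "\<And>i s. i \<noteq> [] \<Longrightarrow> \<theta> (xprod x i s) = (if s = 0 then ribbon_value c i else 0)"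
    using ribbon_functional[OF ribbon_value_relations[OF c]] by blast
  obtain g where g: "functional scale g"
    and gv: "\<And>i s. i \<noteq> [] \<Longrightarrow> g (xprod x i s) = (if s = 0 then inverse (ribbon_value c i) else 0)"
    using ribbon_functional[of "\<lambda>i. inverse (ribbon_value c i)"] ribbon_value_relations[OF c] by auto
  have inv: "dual_inverse scale \<Delta> \<epsilon> \<theta> g"
    by (rule diagonal_dual_inverse[OF \<theta> g \<theta>v gv nz])
  have bil: "bilinear_map scale scale (\<lambda>a1 a2. scale (\<theta> a1) a2)" "bilinear_map scale scale (\<lambda>a1 a2. scale (\<theta> a2) a1)"
    using \<theta> unfolding functional_iff bilinear_map_def
    by (auto simp: scale_left_distrib scale_right_distrib mult.commute)
  have cr1: "(\<Sum>(x1, x2)\<leftarrow>\<Delta> a. scale (\<theta> x1) x2) = (\<Sum>(x1, x2)\<leftarrow>\<Delta> a. scale (\<theta> x2) x1)" for a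
  proof (induction a rule: xprod_induct)
    case (1 i s)
    then show ?case using mod2_cases[of s]
      by (auto simp: sweedler_xprod[OF bil(1)] sweedler_xprod[OF bil(2)] sum_mod2 \<theta>v ribbon_value_shift)
  qed (simp_all add: sweedler_add[OF bil(1)] sweedler_add[OF bil(2)]
      sweedler_scale[OF bil(1) module_scale] sweedler_scale[OF bil(2) module_scale])
  have words: "(\<lambda>b. \<theta> (xprod x i s * b)) = twisted_product \<theta> (xprod x i s)" if "i \<noteq> []" for i s
  proof (rule functional_eqI)
    show "functional scale (\<lambda>b. \<theta> (xprod x i s * b))"
      using \<theta> unfolding functional_iff by (simp add: distrib_left scale_mult_right)
    show "functional scale (twisted_product \<theta> (xprod x i s))"
      by (rule twisted_product_rules[OF \<theta>])
    fix j t assume "j \<noteq> ([]::2 list)"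
    with that show "\<theta> (xprod x i s * xprod x j t) = twisted_product \<theta> (xprod x i s) (xprod x j t)"
      by (subst twisted_product_xprod[OF \<theta> that, where g = "ribbon_value c i" and h = "ribbon_value c j"])
         (auto simp: \<theta>v ribbon_value_shift xprod_mult ribbon_value_append functional_0[OF \<theta>])
  qed
  have "(\<lambda>a. \<theta> (a * b)) = (\<lambda>a. twisted_product \<theta> a b)" for b
  proof (intro functional_eqI)
    show "functional scale (\<lambda>a. \<theta> (a * b))"
      using \<theta> unfolding functional_iff by (simp add: distrib_right scale_mult_left)
    show "functional scale (\<lambda>a. twisted_product \<theta> a b)"
      by (rule twisted_product_rules[OF \<theta>])
  qed (rule fun_cong[OF words])
  then have cr2: "\<theta> (a * b) = twisted_product \<theta> a b" for a b by meson
  have "\<theta> 1 = 1" by (simp add: one ribbon_value_def W_Nil)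
  then show ?thesis
    using \<theta> inv cr1 cr2 \<theta>v unfolding coribbon_def diagonal_values_def twisted_product_def by blast
qed

text \<open>
  On the generators (CR1) says that the matrix of values of \<open>\<theta>\<close> commutes with the matrix of
  generators; by the independence of \<open>x\<^sub>1\<^sub>2\<close> and \<open>x\<^sub>2\<^sub>1\<close> such a matrix is scalar.
\<close>

lemma coribbon_generators:
  assumes "coribbon scale \<Delta> \<epsilon> \<sigma> \<theta>"
  shows "\<theta> (x a (a + s)) = (if s = 0 then \<theta> (x 1 1) else 0)"
proof -
  have \<theta>: "functional scale \<theta>"
    and cr1: "\<And>a. (\<Sum>(x1, x2)\<leftarrow>\<Delta> a. scale (\<theta> x1) x2) = (\<Sum>(x1, x2)\<leftarrow>\<Delta> a. scale (\<theta> x2) x1)"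
    using assms unfolding coribbon_def by auto
  have bil: "bilinear_map scale scale (\<lambda>a1 a2. scale (\<theta> a1) a2)" "bilinear_map scale scale (\<lambda>a1 a2. scale (\<theta> a2) a1)"
    using \<theta> unfolding functional_iff bilinear_map_def
    by (auto simp: scale_left_distrib scale_right_distrib mult.commute)
  have "(\<Sum>t\<in>UNIV. scale (\<theta> (xprod x [1] t)) (xprod x (shift t [1]) (s + t))) =
    (\<Sum>t\<in>UNIV. scale (\<theta> (xprod x (shift t [1]) (s + t))) (xprod x [1] t))" for s
    using cr1[of "xprod x [1] s"] sweedler_xprod[OF bil(1), of "[1]" s] sweedler_xprod[OF bil(2), of "[1]" s] by simp
  from this[of 0] this[of 1]
  have eq: "scale (\<theta> (x 1 0)) (x 0 1) = scale (\<theta> (x 0 1)) (x 1 0)"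
    "scale (\<theta> (x 1 1)) (x 1 0) + scale (\<theta> (x 1 0)) (x 0 0) = scale (\<theta> (x 1 0)) (x 1 1) + scale (\<theta> (x 0 0)) (x 1 0)"
    by (simp_all add: sum_mod2)
  have 0: "\<theta> (x 1 0) = 0" "\<theta> (x 0 1) = 0"
    using off_diagonal_independent[OF eq(1)] by auto
  have "scale 0 (x 0 1) = scale (\<theta> (x 1 1) - \<theta> (x 0 0)) (x 1 0)"
    using eq(2) by (simp add: 0 scale_left_diff_distrib)
  from off_diagonal_independent[OF this] have "\<theta> (x 1 1) = \<theta> (x 0 0)" by simp
  then show ?thesis using 0 mod2_cases[of a] mod2_cases[of s] by auto
qed

text \<open>
  The ratio \<open>c / \<omega>\<close>, chosen so that the formula for words has the value \<open>\<omega>\<close> at a single letter.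
\<close>

definition framing :: 'k where "framing = \<kappa> / W [1]"

lemma framing_nz: "framing \<noteq> 0"
  using \<kappa> W_nz by (simp add: framing_def)

lemma ribbon_value_single: "ribbon_value (\<omega> * framing) [a] = \<omega>"
proof -
  have "[a] = shift (a + 1) [1]" by (simp add: algebra_simps)
  then have "W [a] = W [1]" by (metis W_shift)
  then show ?thesis using \<kappa> W_nz[of "[1]"] by (simp add: ribbon_value_def framing_def)
qed

text \<open>
  Splitting off the first letter, (CR2) determines \<open>\<theta>\<close> on a word from its value on a letter and on
  a shorter word. Applying \<open>\<theta>\<close> to the unit relation then gives the condition on \<open>c\<close>.
\<close>

lemma coribbon_diagonal_values:
  assumes cor: "coribbon scale \<Delta> \<epsilon> \<sigma> \<theta>"
  defines "c \<equiv> \<theta> (x 1 1) * framing"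
  shows "diagonal_values c \<theta>" "c ^ (2 * N) = 1"
proof -
  have \<theta>: "functional scale \<theta>" and one: "\<theta> 1 = 1" and cr2: "\<And>a b. \<theta> (a * b) = twisted_product \<theta> a b"
    using cor unfolding coribbon_def twisted_product_def by auto
  have gen: "\<theta> (xprod x [a] s) = (if s = 0 then ribbon_value c [a] else 0)" for a s
    using coribbon_generators[OF cor, of a s] by (simp add: c_def ribbon_value_single)
  have val: "i \<noteq> [] \<Longrightarrow> \<theta> (xprod x i s) = (if s = 0 then ribbon_value c i else 0)" for i s
  proof (induction "length i" arbitrary: i s)
    case (Suc n)
    obtain a j where i: "i = a # j" using Suc.prems by (cases i) auto
    show ?case
    proof (cases "j = []")
      case True
      then show ?thesis using gen[of a s] by (simp add: i)
    next
      case False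
      have j: "\<theta> (xprod x (shift t j) r) = (if r = 0 then ribbon_value c j else 0)" for t r
        using Suc.hyps(1)[of "shift t j"] Suc.hyps(2) False by (simp add: i ribbon_value_shift)
      have a: "\<theta> (xprod x (shift t [a]) r) = (if r = 0 then ribbon_value c [a] else 0)" for t r
        using gen[of "a + t" r] ribbon_value_shift[of c t "[a]"] by simp
      have "\<theta> (xprod x i s) = twisted_product \<theta> (xprod x [a] s) (xprod x j s)"
        unfolding cr2[symmetric] by (simp add: i xprod_Cons)
      also have "\<dots> = (if s = 0 then ribbon_value c ([a] @ j) else 0)"
        by (subst twisted_product_xprod[OF \<theta> _ False a j]) (auto simp only: ribbon_value_append, simp)
      finally show ?thesis by (simp add: i)
    qed
  qed simp
  then show "diagonal_values c \<theta>" unfolding diagonal_values_def by blast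
  have "1 = \<theta> (xprod x (replicate (2 * N) 1) 0 + scale \<nu> (xprod x (replicate (2 * N) 1) 1))"
    using one unit by simp
  also have "\<dots> = ribbon_value c (replicate (2 * N) 1)"
    using \<theta> N unfolding functional_iff by (simp add: val)
  also have "\<dots> = c ^ (2 * N)"
  proof -
    have "W (replicate (2 * N) 1) = 1" using W_even_block[of "[]" N 1 "[]"] W_Nil by simp
    moreover have sq: "(2 * N)\<^sup>2 = 0 + 4 * N * N" by (simp add: power2_eq_square)
    ultimately show ?thesis unfolding ribbon_value_def length_replicate sq \<kappa>_power by simp
  qed
  finally show "c ^ (2 * N) = 1" ..
qed

text \<open>
  Reversal and squares do not change \<open>W\<close>, and the length is multiplied by \<open>4N - 1\<close>, whose square
  is 1 modulo \<open>4N\<close>; so only the power of \<open>c\<close> changes.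
\<close>

lemma antipode_ribbon_value:
  "ribbon_value c (rev i @ replicate (2 * ((2 * N - 1) * length i)) 1) = c ^ (2 * ((2 * N - 1) * length i)) * ribbon_value c i"
proof -
  let ?n = "length i" and ?k = "(2 * N - 1) * length i"
  obtain M where M: "N = Suc M" using N by (cases N) auto
  have sq: "(?n + 2 * ?k)\<^sup>2 = ?n\<^sup>2 + 4 * N * ((4 * N - 2) * ?n\<^sup>2)"
    by (simp add: M power2_eq_square algebra_simps)
  have W: "W (rev i @ replicate (2 * ?k) 1) = W i"
    using W_even_block[of "rev i" ?k 1 "[]"] W_rev by simp
  show ?thesis
    unfolding ribbon_value_def W length_append length_rev length_replicate sq \<kappa>_power
    by (simp add: power_add)
qed

text \<open>
  Since \<open>c\<^bsup>2N\<^esup> = 1\<close>, the antipode multiplies the value on a word of length \<open>n\<close> by \<open>c\<^bsup>-2n\<^esup>\<close>. A single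
  letter shows that \<open>c\<^sup>2 = 1\<close> is necessary, and it is enough for all words.
\<close>

lemma hopf_coribbon_iff:
  assumes cor: "coribbon scale \<Delta> \<epsilon> \<sigma> \<theta>" and val: "diagonal_values c \<theta>" and c: "c ^ (2 * N) = 1"
  shows "hopf_coribbon scale \<Delta> \<epsilon> S \<sigma> \<theta> \<longleftrightarrow> c\<^sup>2 = 1"
proof -
  have \<theta>: "functional scale \<theta>" using cor unfolding coribbon_def by blast
  have c0: "c \<noteq> 0" using c N by (auto simp: power_0_left)
  have v: "\<theta> (S (xprod x i s)) = (if s = 0 then c ^ (2 * ((2 * N - 1) * length i)) * ribbon_value c i else 0)"
    if "i \<noteq> []" for i s
    using val that unfolding diagonal_values_def
    by (simp add: antipode_xprod antipode_ribbon_value del: One_nat_def)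
  have "c ^ (2 * (2 * N - 1)) * c\<^sup>2 = (c ^ (2 * N))\<^sup>2"
  proof -
    have "2 * (2 * N - 1) + 2 = 2 * N * 2" using N by (cases N) auto
    then show ?thesis by (metis power_add power_mult)
  qed
  then have cc: "c ^ (2 * (2 * N - 1)) * c\<^sup>2 = 1" using c by simp
  show ?thesis
  proof
    assume "hopf_coribbon scale \<Delta> \<epsilon> S \<sigma> \<theta>"
    then have "\<theta> (S (xprod x [1] 0)) = \<theta> (xprod x [1] 0)"
      unfolding hopf_coribbon_def by (metis comp_apply)
    moreover have "ribbon_value c [1] \<noteq> 0" using W_nz \<kappa> c0 by (simp add: ribbon_value_def)
    ultimately have "c ^ (2 * (2 * N - 1)) = 1"
      using val[unfolded diagonal_values_def, rule_format, of "[1]" 0] v[of "[1]" 0] by simp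
    then show "c\<^sup>2 = 1" using cc by simp
  next
    assume c2: "c\<^sup>2 = 1"
    have "\<theta> \<circ> S = \<theta>"
    proof (rule functional_eqI)
      show "functional scale (\<theta> \<circ> S)"
        using \<theta> antipode_linear unfolding functional_iff Vector_Spaces.linear_iff by simp
      show "(\<theta> \<circ> S) (xprod x i s) = \<theta> (xprod x i s)" if "i \<noteq> []" for i s
        using val that v[OF that] unfolding diagonal_values_def by (simp add: power_mult c2)
    qed (rule \<theta>)
    then show "hopf_coribbon scale \<Delta> \<epsilon> S \<sigma> \<theta>"
      unfolding hopf_coribbon_def using cor by blast
  qed
qed

lemma coribbon_extends_iff:
  assumes cor: "coribbon scale \<Delta> \<epsilon> \<sigma> \<theta>"
  shows "extends_theta scale x \<omega> \<theta> \<longleftrightarrow> \<theta> (x 1 1) = \<omega>"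
proof -
  have \<theta>: "functional scale \<theta>" using cor unfolding coribbon_def by blast
  define w where "w = \<theta> (x 1 1)"
  have "\<theta> (x i j) = (if i = j then w else 0)" for i j
    using coribbon_generators[OF cor, of i "i + j"] by (auto simp: add_eq_iff_mod2 w_def)
  then show ?thesis unfolding extends_theta_iff[OF \<theta>] w_def[symmetric] by auto
qed

text \<open>
  A coribbon element is determined by its value \<open>\<omega>\<close> at \<open>x\<^sub>1\<^sub>1\<close>, so the claims about \<open>\<omega>\<close> and the
  count of coribbon elements follow from the conditions on \<open>c = \<omega> * framing\<close>.
\<close>

theorem coribbon_classification:
  assumes two: "(2::'k) \<noteq> 0"
  shows
    "(\<forall>\<omega>. (\<exists>\<theta>. coribbon scale \<Delta> \<epsilon> \<sigma> \<theta> \<and> extends_theta scale x \<omega> \<theta>) \<longleftrightarrow> (\<omega> * framing) ^ (2 * N) = 1) \<and>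
     (\<forall>\<theta>. coribbon scale \<Delta> \<epsilon> \<sigma> \<theta> \<longrightarrow> (\<exists>\<omega>. extends_theta scale x \<omega> \<theta>)) \<and>
     (\<forall>\<omega>. (\<exists>\<theta>. hopf_coribbon scale \<Delta> \<epsilon> S \<sigma> \<theta> \<and> extends_theta scale x \<omega> \<theta>) \<longleftrightarrow>
        \<omega> = inverse framing \<or> \<omega> = - inverse framing) \<and>
     (\<forall>\<omega> \<theta>. coribbon scale \<Delta> \<epsilon> \<sigma> \<theta> \<and> extends_theta scale x \<omega> \<theta> \<longrightarrow>
        (hopf_coribbon scale \<Delta> \<epsilon> S \<sigma> \<theta> \<longleftrightarrow> \<omega> = inverse framing \<or> \<omega> = - inverse framing)) \<and>
     card {\<theta>. hopf_coribbon scale \<Delta> \<epsilon> S \<sigma> \<theta>} = 2"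
proof -
  have ex: "\<exists>\<theta>. coribbon scale \<Delta> \<epsilon> \<sigma> \<theta> \<and> extends_theta scale x \<omega> \<theta>"
    if c: "(\<omega> * framing) ^ (2 * N) = 1" for \<omega>
  proof -
    obtain \<theta> where cor: "coribbon scale \<Delta> \<epsilon> \<sigma> \<theta>" and val: "diagonal_values (\<omega> * framing) \<theta>"
      using coribbon_exists[OF c] by blast
    have "\<theta> (xprod x [1] 0) = \<omega>"
      using val[unfolded diagonal_values_def, rule_format, of "[1]" 0] by (simp add: ribbon_value_single)
    then show ?thesis using cor coribbon_extends_iff[OF cor] by auto
  qed
  have pow: "(\<omega> * framing) ^ (2 * N) = 1"
    if "coribbon scale \<Delta> \<epsilon> \<sigma> \<theta>" "extends_theta scale x \<omega> \<theta>" for \<omega> \<theta>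
    using coribbon_diagonal_values(2)[OF that(1)] coribbon_extends_iff[OF that(1)] that(2) by simp
  have unit_iff: "(\<omega> * framing)\<^sup>2 = 1 \<longleftrightarrow> \<omega> = inverse framing \<or> \<omega> = - inverse framing" for \<omega>
    unfolding power2_eq_1_iff using framing_nz by (auto simp: field_simps)
  have hopf: "hopf_coribbon scale \<Delta> \<epsilon> S \<sigma> \<theta> \<longleftrightarrow> \<omega> = inverse framing \<or> \<omega> = - inverse framing"
    if "coribbon scale \<Delta> \<epsilon> \<sigma> \<theta>" "extends_theta scale x \<omega> \<theta>" for \<omega> \<theta>
    using hopf_coribbon_iff[OF that(1) coribbon_diagonal_values[OF that(1)]]
      coribbon_extends_iff[OF that(1)] that(2) by (simp add: unit_iff)
  have hopf_ex: "(\<exists>\<theta>. hopf_coribbon scale \<Delta> \<epsilon> S \<sigma> \<theta> \<and> extends_theta scale x \<omega> \<theta>) \<longleftrightarrow>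
        \<omega> = inverse framing \<or> \<omega> = - inverse framing" for \<omega>
  proof
    assume "\<omega> = inverse framing \<or> \<omega> = - inverse framing"
    then have "(\<omega> * framing)\<^sup>2 = 1" by (simp only: unit_iff)
    then have "(\<omega> * framing) ^ (2 * N) = 1" by (simp only: power_mult power_one)
    then show "\<exists>\<theta>. hopf_coribbon scale \<Delta> \<epsilon> S \<sigma> \<theta> \<and> extends_theta scale x \<omega> \<theta>"
      using ex hopf \<open>\<omega> = inverse framing \<or> \<omega> = - inverse framing\<close> by blast
  qed (use hopf hopf_coribbon_def in blast)
  have inj: "\<theta> = \<theta>'" if "coribbon scale \<Delta> \<epsilon> \<sigma> \<theta>" "coribbon scale \<Delta> \<epsilon> \<sigma> \<theta>'" "\<theta> (x 1 1) = \<theta>' (x 1 1)" for \<theta> \<theta>'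
  proof (rule functional_eqI)
    show "functional scale \<theta>" "functional scale \<theta>'" using that unfolding coribbon_def by auto
    show "\<theta> (xprod x i s) = \<theta>' (xprod x i s)" if "i \<noteq> []" for i s
      using coribbon_diagonal_values(1)[OF \<open>coribbon scale \<Delta> \<epsilon> \<sigma> \<theta>\<close>]
        coribbon_diagonal_values(1)[OF \<open>coribbon scale \<Delta> \<epsilon> \<sigma> \<theta>'\<close>] that \<open>\<theta> (x 1 1) = \<theta>' (x 1 1)\<close>
      unfolding diagonal_values_def by simp
  qed
  have "bij_betw (\<lambda>\<theta>. \<theta> (x 1 1)) {\<theta>. hopf_coribbon scale \<Delta> \<epsilon> S \<sigma> \<theta>} {inverse framing, - inverse framing}"
    unfolding bij_betw_def
  proof
    show "inj_on (\<lambda>\<theta>. \<theta> (x 1 1)) {\<theta>. hopf_coribbon scale \<Delta> \<epsilon> S \<sigma> \<theta>}"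
      by (rule inj_onI) (use inj hopf_coribbon_def in blast)
    show "(\<lambda>\<theta>. \<theta> (x 1 1)) ` {\<theta>. hopf_coribbon scale \<Delta> \<epsilon> S \<sigma> \<theta>} = {inverse framing, - inverse framing}"
    proof (intro set_eqI iffI)
      fix \<omega> assume "\<omega> \<in> {inverse framing, - inverse framing}"
      then obtain \<theta> where "hopf_coribbon scale \<Delta> \<epsilon> S \<sigma> \<theta>" "extends_theta scale x \<omega> \<theta>"
        using hopf_ex by blast
      then show "\<omega> \<in> (\<lambda>\<theta>. \<theta> (x 1 1)) ` {\<theta>. hopf_coribbon scale \<Delta> \<epsilon> S \<sigma> \<theta>}"
        using coribbon_extends_iff[of \<theta> \<omega>] unfolding hopf_coribbon_def by auto
    next
      fix \<omega> assume "\<omega> \<in> (\<lambda>\<theta>. \<theta> (x 1 1)) ` {\<theta>. hopf_coribbon scale \<Delta> \<epsilon> S \<sigma> \<theta>}"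
      then obtain \<theta> where "hopf_coribbon scale \<Delta> \<epsilon> S \<sigma> \<theta>" "\<omega> = \<theta> (x 1 1)" by blast
      then have "hopf_coribbon scale \<Delta> \<epsilon> S \<sigma> \<theta> \<and> extends_theta scale x \<omega> \<theta>"
        by (simp add: coribbon_extends_iff hopf_coribbon_def)
      then show "\<omega> \<in> {inverse framing, - inverse framing}" using hopf_ex by blast
    qed
  qed
  moreover have "inverse framing \<noteq> - inverse framing"
  proof
    assume "inverse framing = - inverse framing"
    then have "2 * inverse framing = 0" by (metis add.right_inverse mult_2)
    then show False using two framing_nz by simp
  qed
  ultimately have "card {\<theta>. hopf_coribbon scale \<Delta> \<epsilon> S \<sigma> \<theta>} = 2"
    by (simp add: bij_betw_same_card)
  moreover have "\<exists>\<omega>. extends_theta scale x \<omega> \<theta>" if "coribbon scale \<Delta> \<epsilon> \<sigma> \<theta>" for \<theta>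
    by (simp add: coribbon_extends_iff[OF that])
  ultimately show ?thesis using ex pow hopf hopf_ex by blast
qed

end

section \<open>The two families of braidings\<close>

lemma of_nat_mod2: "(of_nat n :: 2) = (if even n then 0 else 1)"
  by (induction n) auto

lemma sgn_count_shift_of_nat: "sgn_count (shift (of_nat n) i) = (-1) ^ n * sgn_count i"
  by (simp add: sgn_count_shift of_nat_mod2)

lemma count_list_shift_1: "count_list (shift 1 i) a = count_list i (a + 1)"
proof (induction i)
  case (Cons b i)
  then show ?case using mod2_cases[of a] mod2_cases[of b] by auto
qed simp

lemma length_count_mod2: "length i = count_list i (1::2) + count_list i 0"
proof (induction i)
  case (Cons b i)
  then show ?case using mod2_cases[of b] by auto
qed simp

context suzuki
begin

text \<open>
  Two letters contribute \<open>\<alpha> = \<kappa> \<rho>\<close> if they are equal when they meet and \<open>\<beta> = \<kappa> / \<rho>\<close> otherwise, and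
  every crossing flips both. The exponent of \<open>\<rho>\<close> is therefore a sum over pairs of positions of a
  product of signs, which factors, up to a sign, into the two signed counts. In this form the full
  twist is governed by the square of the signed count, and \<open>W_alt\<close> holds because the squares for
  the two alternating words differ by a multiple of \<open>4L\<close>, while \<open>\<rho>\<^bsup>4L\<^esup> = (\<alpha> / \<beta>)\<^bsup>2L\<^esup> = 1\<close>.
\<close>

lemma sigma_suzuki_braided:
  assumes \<kappa>\<rho>: "\<kappa> * \<rho> = \<alpha>" "\<kappa> / \<rho> = \<beta>" and nz: "\<kappa> \<noteq> 0" "\<rho> \<noteq> 0"
    and roots: "(\<alpha> * \<beta>) ^ N = \<nu>" "(\<alpha> * inverse \<beta>) ^ L = l"
    and \<sigma>: "sigma_braiding scale x \<Delta> \<epsilon> \<alpha> \<beta> \<sigma>"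
  shows "suzuki_braided scale N L \<nu> l x \<Delta> \<epsilon> S \<sigma> 1
    (\<lambda>i j. \<kappa> ^ (length i * length j) * \<rho> powi (- ((-1) ^ length j * sgn_count i * sgn_count j)))
    \<kappa> (\<lambda>i. \<rho> powi (sgn_count i)\<^sup>2)"
proof -
  define B where "B i j = \<kappa> ^ (length i * length j) * \<rho> powi (- ((-1) ^ length j * sgn_count i * sgn_count j))" for i j
  have braid: "braiding scale \<Delta> \<epsilon> \<sigma>" using \<sigma> unfolding sigma_braiding_def by blast
  have gens: "\<sigma> (x a (a + s)) (x b (b + t)) = (if s = 1 \<and> t = 1 then B [a] [b] else 0)" for a b s t
  proof -
    have B: "B [a] [b] = (if a = b then \<alpha> else \<beta>)"
      unfolding \<kappa>\<rho>[symmetric] using mod2_cases[of a] mod2_cases[of b]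
      by (auto simp: B_def power_int_minus divide_inverse)
    have vals: "\<sigma> (x 1 0) (x 1 0) = \<alpha>" "\<sigma> (x 0 1) (x 0 1) = \<alpha>"
        "\<sigma> (x 1 0) (x 0 1) = \<beta>" "\<sigma> (x 0 1) (x 1 0) = \<beta>"
      using \<sigma> unfolding sigma_braiding_def two_eq_zero_mod2 by blast+
    have zero: "\<sigma> (x i j) (x p q) = 0"
      if "(i, j, p, q) \<notin> {(1,0,1,0), (0,1,0,1), (1,0,0,1), (0,1,1,0)}" for i j p q
      using \<sigma> that unfolding sigma_braiding_def two_eq_zero_mod2 by blast
    show ?thesis unfolding B
      using mod2_cases[of a] mod2_cases[of b] mod2_cases[of s] mod2_cases[of t]
      by (elim disjE) (simp_all add: vals zero)
  qed
  have powi_add: "\<rho> powi (a + b) = \<rho> powi a * \<rho> powi b" for a b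
    using nz by (simp add: power_int_add)
  have BB: "B i j * B i' j' = \<kappa> ^ (length i * length j + length i' * length j') *
      \<rho> powi (- ((-1) ^ length j * sgn_count i * sgn_count j) + - ((-1) ^ length j' * sgn_count i' * sgn_count j'))"
    for i j i' j'
    by (simp only: B_def power_add powi_add) (simp only: ac_simps)
  have B1: "B (a # i) j = B [a] j * B i (shift 1 j)" for a i j
    unfolding BB by (simp add: B_def sgn_count_shift algebra_simps)
  have B2: "B [a] (b # j) = B [a] j * B (shift (1 * of_nat (length j)) [a]) [b]" for a b j
    unfolding BB mult_1 sgn_count_shift_of_nat by (simp add: B_def algebra_simps)
  have \<rho>\<rho>: "\<rho>\<^sup>2 = \<alpha> * inverse \<beta>" and \<kappa>\<kappa>: "\<kappa>\<^sup>2 = \<alpha> * \<beta>"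
    unfolding \<kappa>\<rho>[symmetric] using nz by (simp_all add: field_simps power2_eq_square)
  have "\<rho> ^ (4 * L) = ((\<rho>\<^sup>2) ^ L)\<^sup>2" by (simp flip: power_mult)
  then have \<rho>L: "\<rho> ^ (4 * L) = 1" unfolding \<rho>\<rho> roots(2) using l by auto
  have "\<kappa> ^ (4 * N) = ((\<kappa>\<^sup>2) ^ N)\<^sup>2" by (simp flip: power_mult)
  then have \<kappa>N: "\<kappa> ^ (4 * N) = 1" unfolding \<kappa>\<kappa> roots(1) using \<nu> by auto
  have \<rho>_period: "\<rho> powi (a + int (4 * L) * b) = \<rho> powi a" for a b
    by (simp only: powi_add power_int_mult power_int_of_nat \<rho>L) simp
  have "suzuki_braided scale N L \<nu> l x \<Delta> \<epsilon> S \<sigma> 1 B \<kappa> (\<lambda>i. \<rho> powi (sgn_count i)\<^sup>2)"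
  proof (unfold_locales, goal_cases)
    case 1
    show ?case by (rule braid)
  next
    case (2 i j s t)
    show ?case by (rule braiding_xprod[OF braid gens B1 B2 2])
  next
    case (3 i j)
    show ?case using nz by (simp add: B_def)
  next
    case (4 i j)
    let ?e = "(-1::int) ^ length i" and ?d = "(-1::int) ^ length j"
    have e: "?e * ?e = 1" "?d * ?d = 1" by (simp_all flip: power_add add: mult_2[symmetric])
    have "- (?d * (?d * sgn_count i) * (?e * sgn_count j)) + - (?e * sgn_count j * sgn_count i)
        + (sgn_count i + ?e * sgn_count j)\<^sup>2 = - ((?d * ?d) * (?e * sgn_count i * sgn_count j)) - ?e * sgn_count j * sgn_count i
        + (sgn_count i)\<^sup>2 + 2 * ?e * sgn_count i * sgn_count j + (?e * ?e) * (sgn_count j)\<^sup>2"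
      by (simp add: power2_eq_square algebra_simps)
    also have "\<dots> = (sgn_count i)\<^sup>2 + (sgn_count j)\<^sup>2"
      unfolding e by simp
    finally have ex: "- (?d * (?d * sgn_count i) * (?e * sgn_count j)) + - (?e * sgn_count j * sgn_count i)
        + (sgn_count i + ?e * sgn_count j)\<^sup>2 = (sgn_count i)\<^sup>2 + (sgn_count j)\<^sup>2" .
    have "B (shift (1 * of_nat (length j)) i) (shift (1 * of_nat (length i)) j) * B j i * \<rho> powi (sgn_count (i @ j))\<^sup>2
      = \<kappa> ^ (2 * length i * length j) * \<rho> powi (- (?d * (?d * sgn_count i) * (?e * sgn_count j)) + - (?e * sgn_count j * sgn_count i)
        + (sgn_count i + ?e * sgn_count j)\<^sup>2)"
      unfolding BB sgn_count_append mult_1 sgn_count_shift_of_nat powi_add shift_simps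
      by (simp add: algebra_simps mult_2 mult_2_right)
    then show ?case unfolding ex powi_add by (simp only: mult.assoc)
  next
    case 5
    show ?case by (rule nz)
  next
    case 6
    show ?case by (rule \<kappa>N)
  next
    case (7 i)
    show ?case using nz by simp
  next
    case 8
    show ?case by simp
  next
    case (9 t i)
    show ?case by (simp add: sgn_count_shift)
  next
    case (10 i)
    show ?case by (simp add: sgn_count_rev)
  next
    case (11 u a v)
    show ?case by (simp add: sgn_count_append)
  next
    case (12 u v)
    define e where "e = (-1::int) ^ length u"
    define X where "X = sgn_count u + e * ((-1) ^ L * sgn_count v)"
    have cnt: "sgn_count (u @ alt L 0 1 @ v) = X - e * int L"
      "sgn_count (u @ alt L 1 0 @ v) = X + e * int L"
      by (simp_all add: X_def e_def sgn_count_append sgn_count_alt algebra_simps)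
    have "(sgn_count (u @ alt L 1 0 @ v))\<^sup>2 = (sgn_count (u @ alt L 0 1 @ v))\<^sup>2 + int (4 * L) * (e * X)"
      unfolding cnt by (simp add: power2_eq_square algebra_simps)
    then show ?case by (simp only: \<rho>_period)
  qed
  then show ?thesis unfolding B_def .
qed

text \<open>
  Here a crossing does not change the letters, so \<open>B\<close> only counts the pairs of letters of each
  kind. As \<open>\<gamma>\<^sup>2 = \<delta>\<^sup>2\<close>, the double braiding of two letters is \<open>\<gamma>\<^sup>2\<close> with an additional sign \<open>l\<close> if they
  differ, and a word accumulates one sign \<open>l\<close> for each pair of different letters.
\<close>

lemma tau_suzuki_braided:
  assumes L2: "L = 2" and nz: "\<gamma> \<noteq> 0" "\<delta> \<noteq> 0" and sq: "\<gamma> ^ 2 = \<delta> ^ 2" and root: "\<gamma> ^ (2 * N) = 1"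
    and \<tau>: "tau_braiding scale x \<Delta> \<epsilon> l \<gamma> \<delta> \<tau>"
  shows "suzuki_braided scale N L \<nu> l x \<Delta> \<epsilon> S \<tau> 0
    (\<lambda>i j. \<gamma> ^ (count_list i 1 * count_list j 1 + count_list i 0 * count_list j 0)
       * \<delta> ^ (count_list i 1 * count_list j 0 + count_list i 0 * count_list j 1)
       * l ^ (count_list i 0 * count_list j 1))
    \<gamma> (\<lambda>i. l ^ (count_list i 1 * count_list i 0))"
proof -
  define B where "B i j = \<gamma> ^ (count_list i 1 * count_list j 1 + count_list i 0 * count_list j 0)
       * \<delta> ^ (count_list i 1 * count_list j 0 + count_list i 0 * count_list j 1)
       * l ^ (count_list i 0 * count_list j 1)" for i j :: "2 list"
  have braid: "braiding scale \<Delta> \<epsilon> \<tau>" using \<tau> unfolding tau_braiding_def by blast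
  have gens: "\<tau> (x a (a + s)) (x b (b + t)) = (if s = 0 \<and> t = 0 then B [a] [b] else 0)" for a b s t
    using \<tau> mod2_cases[of a] mod2_cases[of b] mod2_cases[of s] mod2_cases[of t]
    unfolding tau_braiding_def two_eq_zero_mod2 by (auto simp: B_def)
  have B1: "B (a # i) j = B [a] j * B i (shift 0 j)" for a i j
    using mod2_cases[of a] by (auto simp: B_def power_add)
  have B2: "B [a] (b # j) = B [a] j * B (shift (0 * of_nat (length j)) [a]) [b]" for a b j
    using mod2_cases[of a] mod2_cases[of b] by (auto simp: B_def power_add)
  have l0: "l \<noteq> 0" using l by auto
  have ll: "l ^ (2 * n) = 1" for n using l by (auto simp: power_mult)
  have \<delta>2: "\<delta> ^ (2 * n) = \<gamma> ^ (2 * n)" for n by (simp add: power_mult sq)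
  have W_square: "l ^ ((p + 2) * q) = l ^ (p * q)" "l ^ (p * (q + 2)) = l ^ (p * q)" for p q
    by (simp_all only: add_mult_distrib add_mult_distrib2 power_add ll mult.commute[of p 2] mult_1_right)
  have "suzuki_braided scale N L \<nu> l x \<Delta> \<epsilon> S \<tau> 0 B \<gamma> (\<lambda>i. l ^ (count_list i 1 * count_list i 0))"
  proof (unfold_locales, goal_cases)
    case 1
    show ?case by (rule braid)
  next
    case (2 i j s t)
    show ?case by (rule braiding_xprod[OF braid gens B1 B2 2])
  next
    case (3 i j)
    show ?case using nz l0 by (simp add: B_def)
  next
    case (4 i j)
    define p q p' q' where "p = count_list i (1::2)" "q = count_list i (0::2)" "p' = count_list j (1::2)" "q' = count_list j (0::2)"
    have "B i j * B j i * l ^ ((p + p') * (q + q')) =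
      \<gamma> ^ (2 * (p * p' + q * q')) * \<delta> ^ (2 * (p * q' + q * p')) * l ^ (p * q) * l ^ (p' * q') * l ^ (2 * (p * q' + q * p'))"
      unfolding B_def p_q_p'_q'_def[symmetric]
      by (simp only: mult_2 add_mult_distrib add_mult_distrib2 power_add) (simp only: ac_simps)
    also have "\<dots> = \<gamma> ^ (2 * (p + q) * (p' + q')) * l ^ (p * q) * l ^ (p' * q')"
      unfolding \<delta>2 ll by (simp add: algebra_simps flip: power_add)
    finally show ?case unfolding length_count_mod2 by (simp add: p_q_p'_q'_def)
  next
    case 5
    show ?case by (rule nz)
  next
    case 6
    have "4 * N = 2 * N * 2" by simp
    then show ?case by (simp only: power_mult[of _ "2 * N" 2] root) simp
  next
    case (7 i)
    show ?case using l0 by simp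
  next
    case 8
    show ?case by simp
  next
    case (9 t i)
    show ?case using mod2_cases[of t] by (auto simp: count_list_shift_1 mult.commute)
  next
    case (10 i)
    show ?case by simp
  next
    case (11 u a v)
    show ?case
      using mod2_cases[of a] W_square[of "count_list (u @ v) 1" "count_list (u @ v) 0"]
      by (auto simp: add_ac)
  next
    case (12 u v)
    show ?case by (simp add: L2 numeral_2_eq_2 add_ac)
  qed
  then show ?thesis unfolding B_def .
qed

end

theorem theorem3p8:
  fixes scale :: "'k::alg_closed_field \<Rightarrow> 'a::ring_1 \<Rightarrow> 'a"
    and N L :: nat and \<nu> l :: 'k
    and x :: "2 \<Rightarrow> 2 \<Rightarrow> 'a"
    and \<Delta> :: "'a \<Rightarrow> ('a \<times> 'a) list" and \<epsilon> :: "'a \<Rightarrow> 'k" and S :: "'a \<Rightarrow> 'a"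
  assumes "N \<ge> 1" and "L \<ge> 2" and "\<nu> \<in> {1, -1}" and "l \<in> {1, -1}"
    and "\<not> CHAR('k) dvd 2 * N * L"
    and "suzuki_hopf_algebra scale N L \<nu> l x \<Delta> \<epsilon> S"
  shows
    "(\<forall>\<alpha> \<beta> \<sigma>. \<alpha> \<noteq> 0 \<and> \<beta> \<noteq> 0 \<and> (\<alpha> * \<beta>) ^ N = \<nu> \<and> (\<alpha> * inverse \<beta>) ^ L = l \<and>
        sigma_braiding scale x \<Delta> \<epsilon> \<alpha> \<beta> \<sigma> \<longrightarrow>
        (\<forall>\<omega>. (\<exists>\<theta>. coribbon scale \<Delta> \<epsilon> \<sigma> \<theta> \<and> extends_theta scale x \<omega> \<theta>) \<longleftrightarrow>
              \<omega> ^ (2 * N) = \<alpha> ^ (2 * N)) \<and>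
        (\<forall>\<theta>. coribbon scale \<Delta> \<epsilon> \<sigma> \<theta> \<longrightarrow> (\<exists>\<omega>. extends_theta scale x \<omega> \<theta>)) \<and>
        (\<forall>\<omega>. (\<exists>\<theta>. hopf_coribbon scale \<Delta> \<epsilon> S \<sigma> \<theta> \<and> extends_theta scale x \<omega> \<theta>) \<longleftrightarrow>
              \<omega> = inverse \<beta> \<or> \<omega> = - inverse \<beta>) \<and>
        (\<forall>\<omega> \<theta>. coribbon scale \<Delta> \<epsilon> \<sigma> \<theta> \<and> extends_theta scale x \<omega> \<theta> \<longrightarrow>
              (hopf_coribbon scale \<Delta> \<epsilon> S \<sigma> \<theta> \<longleftrightarrow> \<omega> = inverse \<beta> \<or> \<omega> = - inverse \<beta>)) \<and>
        card {\<theta>. hopf_coribbon scale \<Delta> \<epsilon> S \<sigma> \<theta>} = 2) \<and>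
     (L = 2 \<longrightarrow>
      (\<forall>\<gamma> \<delta> \<tau>. \<gamma> \<noteq> 0 \<and> \<delta> \<noteq> 0 \<and> \<gamma> ^ 2 = \<delta> ^ 2 \<and> \<gamma> ^ (2 * N) = 1 \<and>
        tau_braiding scale x \<Delta> \<epsilon> l \<gamma> \<delta> \<tau> \<longrightarrow>
        (\<forall>\<omega>. (\<exists>\<theta>. coribbon scale \<Delta> \<epsilon> \<tau> \<theta> \<and> extends_theta scale x \<omega> \<theta>) \<longleftrightarrow>
              \<omega> ^ (2 * N) = 1) \<and>
        (\<forall>\<theta>. coribbon scale \<Delta> \<epsilon> \<tau> \<theta> \<longrightarrow> (\<exists>\<omega>. extends_theta scale x \<omega> \<theta>)) \<and>
        (\<forall>\<omega>. (\<exists>\<theta>. hopf_coribbon scale \<Delta> \<epsilon> S \<tau> \<theta> \<and> extends_theta scale x \<omega> \<theta>) \<longleftrightarrow>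
              \<omega> = inverse \<gamma> \<or> \<omega> = - inverse \<gamma>) \<and>
        (\<forall>\<omega> \<theta>. coribbon scale \<Delta> \<epsilon> \<tau> \<theta> \<and> extends_theta scale x \<omega> \<theta> \<longrightarrow>
              (hopf_coribbon scale \<Delta> \<epsilon> S \<tau> \<theta> \<longleftrightarrow> \<omega> = inverse \<gamma> \<or> \<omega> = - inverse \<gamma>)) \<and>
        card {\<theta>. hopf_coribbon scale \<Delta> \<epsilon> S \<tau> \<theta>} = 2))"
proof -
  interpret suzuki scale N L \<nu> l x \<Delta> \<epsilon> S
    by unfold_locales (fact assms)+
  have two: "(2::'k) \<noteq> 0"
  proof
    assume "(2::'k) = 0"
    then have "CHAR('k) dvd 2" using of_nat_eq_0_iff_char_dvd[of 2, where 'a = 'k] by simp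
    then show False using assms(5) by (metis dvd_mult2)
  qed
  show ?thesis
  proof ((rule conjI; intro allI impI; elim conjE), goal_cases)
    case (1 \<alpha> \<beta> \<sigma>)
    note nz = 1(1,2) and roots = 1(3,4) and \<sigma> = 1(5)
    (* square roots kappa of alpha * beta and rho of alpha / beta with kappa * rho = alpha *)
    obtain \<kappa> where \<kappa>: "\<kappa>\<^sup>2 = \<alpha> * \<beta>" using nth_root_exists[of 2 "\<alpha> * \<beta>"] by auto
    define \<rho> where "\<rho> = \<alpha> / \<kappa>"
    have \<kappa>0: "\<kappa> \<noteq> 0" using \<kappa> nz by auto
    have \<kappa>\<rho>: "\<kappa> * \<rho> = \<alpha>" "\<kappa> / \<rho> = \<beta>" "\<rho> \<noteq> 0"
      using \<kappa> \<kappa>0 nz by (auto simp: \<rho>_def field_simps power2_eq_square)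
    interpret b: suzuki_braided scale N L \<nu> l x \<Delta> \<epsilon> S \<sigma> 1
      "\<lambda>i j. \<kappa> ^ (length i * length j) * \<rho> powi (- ((-1) ^ length j * sgn_count i * sgn_count j))"
      \<kappa> "\<lambda>i. \<rho> powi (sgn_count i)\<^sup>2"
      by (rule sigma_suzuki_braided[OF \<kappa>\<rho>(1,2) \<kappa>0 \<kappa>\<rho>(3) roots \<sigma>])
    have framing: "b.framing = \<beta>" by (simp add: b.framing_def \<kappa>\<rho>)
    have "(\<alpha> * \<beta>) ^ (2 * N) = ((\<alpha> * \<beta>) ^ N)\<^sup>2" by (simp add: mult.commute flip: power_mult)
    then have \<alpha>\<beta>: "\<alpha> ^ (2 * N) * \<beta> ^ (2 * N) = 1"
      unfolding roots(1) power_mult_distrib[symmetric] using assms(3) by auto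
    have \<omega>: "(\<omega> * \<beta>) ^ (2 * N) = 1 \<longleftrightarrow> \<omega> ^ (2 * N) = \<alpha> ^ (2 * N)" for \<omega>
    proof -
      have "(\<omega> * \<beta>) ^ (2 * N) = 1 \<longleftrightarrow> \<omega> ^ (2 * N) * \<beta> ^ (2 * N) = \<alpha> ^ (2 * N) * \<beta> ^ (2 * N)"
        unfolding \<alpha>\<beta> power_mult_distrib ..
      then show ?thesis using nz by simp
    qed
    show ?case
      using b.coribbon_classification[OF two] unfolding framing \<omega> .
  next
    case (2 \<gamma> \<delta> \<tau>)
    interpret b: suzuki_braided scale N L \<nu> l x \<Delta> \<epsilon> S \<tau> 0
      "\<lambda>i j. \<gamma> ^ (count_list i 1 * count_list j 1 + count_list i 0 * count_list j 0)
       * \<delta> ^ (count_list i 1 * count_list j 0 + count_list i 0 * count_list j 1)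
       * l ^ (count_list i 0 * count_list j 1)"
      \<gamma> "\<lambda>i. l ^ (count_list i 1 * count_list i 0)"
      by (rule tau_suzuki_braided) (fact 2)+
    have framing: "b.framing = \<gamma>" by (simp add: b.framing_def)
    have \<omega>: "(\<omega> * \<gamma>) ^ (2 * N) = 1 \<longleftrightarrow> \<omega> ^ (2 * N) = 1" for \<omega>
      by (simp only: power_mult_distrib 2(5) mult_1_right)
    show ?case
      using b.coribbon_classification[OF two] unfolding framing \<omega> .
  qed
qed

end
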